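(* Let $\Omega\subset\mathbf{R}^d$ be a $C^{1,1}$-domain with boundary $\Gamma$. Then for all $\delta\ge0$ with $\delta\ne1$ the boundary Hardy inequality is satisfied for all small $r$, i.e. there is $r_0>0$ and for each $r\in(0,r_0)$ an $a>0$ such that $$\|d_\Gamma^{\,\delta/2-1}\psi\|_2\le a\,\|d_\Gamma^{\,\delta/2}(\nabla\psi)\|_2\quad\text{for all }\psi\in C_c^1(\Gamma_r).$$ Moreover, the boundary Hardy constant is given by $a_\delta(\Gamma)=2/|\delta-1|$.
   Context: $d_\Gamma(x)$ is the Euclidean distance from $x$ to the (non-empty) boundary $\Gamma$ of $\Omega$, $\Gamma_r=\{x\in\Omega: d_\Gamma(x)<r\}$, $\|\cdot\|_2$ is the $L_2$-norm, and $C_c^1(W)$ denotes the $C^1$-functions with compact support in the open set $W$. $a_\delta(\Gamma_r)$ is the infimum of the $a>0$ such that $\|d_\Gamma^{\,\delta/2-1}\psi\|_2\le a\,\|d_\Gamma^{\,\delta/2}(\nabla\psi)\|_2$ for all $\psi\in C_c^1(\Gamma_r)$, and $a_\delta(\Gamma)=\inf_{r>0}a_\delta(\Gamma_r)$. $C^{1,1}$-domain: a (bounded or unbounded) domain $\Omega$ is a $C^{1,1}$-domain if it satisfies the uniform interior and exterior ball conditions, i.e. there is a $u>0$ such that for each $x\in\Gamma$ there is a $y\in\Omega$ with $\overline{B}(y;u)\cap\Omega^{\rm c}=\{x\}$ and there is a $y'\in\Omega^{\rm c}$ with $\overline{B}(y';u)\cap\overline\Omega=\{x\}$. (For bounded $\Omega$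 this is equivalent to the usual definition by local $C^{1,1}$-diffeomorphisms.) *)

theory Defs
  imports "HOL-Analysis.Analysis"
begin

definition C11_domain :: "(real ^ 'd) set \<Rightarrow> bool" where
  "C11_domain \<Omega> \<longleftrightarrow> open \<Omega> \<and> connected \<Omega> \<and> \<Omega> \<noteq> {} \<and>
     (\<exists>u>0. \<forall>x\<in>frontier \<Omega>.
        (\<exists>y\<in>\<Omega>. cball y u \<inter> - \<Omega> = {x}) \<and>
        (\<exists>y'\<in>- \<Omega>. cball y' u \<inter> closure \<Omega> = {x}))"

definition bdry_dist :: "(real ^ 'd) set \<Rightarrow> real ^ 'd \<Rightarrow> real" where
  "bdry_dist \<Omega> x = infdist x (frontier \<Omega>)"

definition bdry_layer :: "(real ^ 'd) set \<Rightarrow> real \<Rightarrow> (real ^ 'd) set" where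
  "bdry_layer \<Omega> r = {x \<in> \<Omega>. bdry_dist \<Omega> x < r}"

(* Meaningful only where f is differentiable; the gradient is then unique. *)
definition grad :: "(real ^ 'd \<Rightarrow> real) \<Rightarrow> real ^ 'd \<Rightarrow> real ^ 'd" where
  "grad f x = (THE D. GDERIV f x :> D)"

(* Functions on W are represented by their extension by zero to the whole space:
   the closure of the support, taken in the whole space, is a compact subset of W. *)
definition C1c :: "(real ^ 'd) set \<Rightarrow> (real ^ 'd \<Rightarrow> real) set" where
  "C1c W = {\<psi>. (\<forall>x\<in>W. \<exists>D. GDERIV \<psi> x :> D) \<and> continuous_on W (grad \<psi>) \<and>
     compact (closure {x. \<psi> x \<noteq> 0}) \<and> closure {x. \<psi> x \<noteq> 0} \<subseteq> W}"

(* The Bochner integral is 0 for non-integrable integrands. This does not matter for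
   boundary_hardy below, whose integrands are continuous with compact support in \<Omega>. *)
definition L2_norm :: "(real ^ 'd) set \<Rightarrow> (real ^ 'd \<Rightarrow> 'b::real_normed_vector) \<Rightarrow> real" where
  "L2_norm \<Omega> f = sqrt (LINT x:\<Omega>|lborel. (norm (f x))\<^sup>2)"

definition boundary_hardy :: "(real ^ 'd) set \<Rightarrow> real \<Rightarrow> real \<Rightarrow> real \<Rightarrow> bool" where
  "boundary_hardy \<Omega> \<delta> r a \<longleftrightarrow> (\<forall>\<psi>\<in>C1c (bdry_layer \<Omega> r).
     L2_norm \<Omega> (\<lambda>x. bdry_dist \<Omega> x powr (\<delta> / 2 - 1) * \<psi> x)
       \<le> a * L2_norm \<Omega> (\<lambda>x. bdry_dist \<Omega> x powr (\<delta> / 2) *\<^sub>R grad \<psi> x))"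

(* Extended real, so that the infimum is \<infinity> if no Hardy inequality holds on the layer. *)
definition layer_hardy_const :: "(real ^ 'd) set \<Rightarrow> real \<Rightarrow> real \<Rightarrow> ereal" where
  "layer_hardy_const \<Omega> \<delta> r = Inf {ereal a | a. a > 0 \<and> boundary_hardy \<Omega> \<delta> r a}"

definition boundary_hardy_const :: "(real ^ 'd) set \<Rightarrow> real \<Rightarrow> ereal" where
  "boundary_hardy_const \<Omega> \<delta> = (INF r\<in>{0<..}. layer_hardy_const \<Omega> \<delta> r)"

end

theory Submission
  imports Defs
begin

text \<open>
  The two tangent balls at a boundary point squeeze the distance function \<open>d\<close> between smooth
  functions. Hence near \<open>\<Gamma>\<close> it is differentiable with \<open>|\<nabla>d| = 1\<close> and has second differences of size
  \<open>O(h\<^sup>2)\<close>, so that \<open>|\<integral> \<nabla>d \<bullet> \<nabla>\<phi>| \<le> \<kappa> \<integral> \<phi>\<close> for every \<open>\<phi> \<ge> 0\<close> supported near \<open>\<Gamma>\<close>.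

  For \<open>\<phi> = d\<^bsup>\<delta>-1\<^esup>\<psi>\<^sup>2\<close> this yields
  \<open>(|\<delta> - 1| - \<kappa> r) \<integral> d\<^bsup>\<delta>-2\<^esup>\<psi>\<^sup>2 \<le> 2 \<integral> d\<^bsup>\<delta>-1\<^esup>|\<psi>||\<nabla>\<psi>|\<close>
  on \<open>\<Gamma>\<^sub>r\<close>, which is the Hardy inequality with a constant tending to \<open>2/|\<delta> - 1|\<close> as \<open>r\<close> tends to \<open>0\<close>.

  For the converse take \<open>\<psi> = d\<^bsup>(1-\<delta>)/2\<^esup> g\<^sub>s(d) \<eta>\<close> with a bump \<open>\<eta>\<close> at a boundary point and cutoffs \<open>g\<^sub>s\<close>
  increasing to \<open>1\<close>. As \<open>s\<close> tends to \<open>0\<close>, the left-hand side diverges, because \<open>1/d\<close> is not integrable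
  near the boundary, while the terms with \<open>g\<^sub>s'\<close> and \<open>\<nabla>\<eta>\<close> stay bounded, by the above estimate
  with \<open>\<phi> = g\<^sub>s(d) \<eta>\<close>.
\<close>

section \<open>Bounded second differences\<close>

lemma integrable_compact_support:
  fixes f :: "'a::euclidean_space \<Rightarrow> 'b::euclidean_space"
  assumes "compact K" "continuous_on K f" "\<And>x. x \<notin> K \<Longrightarrow> f x = 0"
  shows "integrable lborel f"
proof -
  have "(\<lambda>x. indicator K x *\<^sub>R f x) = f"
    using assms(3) by (auto simp: indicator_def)
  then show ?thesis
    using borel_integrable_compact[OF assms(1,2)] by simp
qed

lemma gderiv_zero_outside:
  assumes "closed K" "\<And>x. x \<notin> K \<Longrightarrow> f x = 0" "x \<notin> K"
  shows "GDERIV f x :> 0"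
proof -
  have "((\<lambda>x. 0) has_derivative (\<lambda>h. h \<bullet> 0)) (at x)"
    by simp
  then have "(f has_derivative (\<lambda>h. h \<bullet> 0)) (at x)"
    by (rule has_derivative_transform_within_open[where s = "- K"]) (use assms in auto)
  then show ?thesis
    by (simp add: gderiv_def)
qed

lemma gderiv_difference_quotient:
  assumes "GDERIV f x :> D" "h \<longlonglongrightarrow> 0" "\<And>k. h k > (0::real)"
  shows "(\<lambda>k. (f (x + h k *\<^sub>R e) - f x) / h k) \<longlonglongrightarrow> D \<bullet> e"
proof -
  have "((\<lambda>t. f (x + t *\<^sub>R e)) has_derivative (\<lambda>t. (t *\<^sub>R e) \<bullet> D)) (at 0)"
    using assms(1) unfolding gderiv_def
    by (intro has_derivative_compose[where g = f and f = "\<lambda>t. x + t *\<^sub>R e"])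
      (auto intro!: derivative_eq_intros)
  then have "((\<lambda>t. f (x + t *\<^sub>R e)) has_field_derivative (D \<bullet> e)) (at 0)"
    unfolding has_field_derivative_def by (simp add: inner_commute mult_commute_abs)
  then have lim: "((\<lambda>t. (f (x + t *\<^sub>R e) - f x) / t) \<longlongrightarrow> D \<bullet> e) (at 0)"
    unfolding DERIV_def by simp
  have "filterlim h (at 0) sequentially"
    using assms(2,3) by (auto simp: filterlim_at less_imp_neq[symmetric] intro!: always_eventually)
  from filterlim_compose[OF lim this] show ?thesis
    by simp
qed

lemma lborel_integral_translate:
  fixes f :: "'a::euclidean_space \<Rightarrow> real"
  assumes "f \<in> borel_measurable borel"
  shows "(\<integral>x. f (x + a) \<partial>lborel) = (\<integral>x. f x \<partial>lborel)"
proof -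
  have "(\<integral>x. f x \<partial>lborel) = (\<integral>x. f x \<partial>distr lborel borel ((+) a))"
    by (simp add: lborel_distr_plus)
  also have "\<dots> = (\<integral>x. f (a + x) \<partial>lborel)"
    using assms by (subst integral_distr) auto
  finally show ?thesis
    by (simp add: add.commute)
qed

text \<open>A substitute for integration by parts: bounded second differences of \<open>f\<close>
  bound its Laplacian in the distributional sense, with no second derivatives involved.\<close>

lemma second_difference_weak_bound:
  fixes f \<phi> :: "'a::euclidean_space \<Rightarrow> real"
  assumes lip: "\<And>x y. \<bar>f x - f y\<bar> \<le> dist x y"
    and K: "compact K"
    and nonneg: "\<And>x. 0 \<le> \<phi> x"
    and supp: "\<And>x. x \<notin> K \<Longrightarrow> \<phi> x = 0"
    and df: "\<And>x. x \<in> K \<Longrightarrow> GDERIV f x :> \<nu> x"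
    and dphi: "\<And>x. GDERIV \<phi> x :> D x"
    and bound: "\<And>x. norm (D x) \<le> M"
    and e: "e \<in> Basis"
    and h0: "h0 > 0"
    and second: "\<And>x h. x \<in> K \<Longrightarrow> 0 < h \<Longrightarrow> h < h0 \<Longrightarrow>
                   \<bar>f (x + h *\<^sub>R e) + f (x - h *\<^sub>R e) - 2 * f x\<bar> \<le> c * h\<^sup>2"
  shows "integrable lborel (\<lambda>x. (\<nu> x \<bullet> e) * (D x \<bullet> e))"
    and "\<bar>\<integral>x. (\<nu> x \<bullet> e) * (D x \<bullet> e) \<partial>lborel\<bar> \<le> c * (\<integral>x. \<phi> x \<partial>lborel)"
proof -
  have ne: "norm e = 1" using e by simp
  have M0: "0 \<le> M" using norm_ge_zero bound order_trans by blast
  have contf: "continuous_on S f" for S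
    by (rule continuous_on_subset[OF _ subset_UNIV])
       (auto simp: continuous_on_iff dist_real_def intro!: exI order.strict_trans1[OF lip])
  have contphi: "continuous_on S \<phi>" for S
    by (rule continuous_at_imp_continuous_on)
      (use dphi in \<open>auto simp: gderiv_def dest!: has_derivative_continuous\<close>)
  \<comment> \<open>Off \<open>K\<close> the function vanishes on an open set, and gradients are
    unique.\<close>
  have D0: "D x = 0" if "x \<notin> K" for x
  proof -
    have "GDERIV \<phi> x :> 0"
      by (rule gderiv_zero_outside[OF compact_imp_closed[OF K] supp that])
    then have "(\<lambda>h. h \<bullet> D x) = (\<lambda>h. h \<bullet> 0)"
      using dphi[of x] unfolding gderiv_def by (rule has_derivative_unique[rotated])
    then have "D x \<bullet> D x = 0" by (metis inner_zero_right)
    then show ?thesis by simp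
  qed
  have lipphi: "\<bar>\<phi> x - \<phi> y\<bar> \<le> M * norm (x - y)" for x y
  proof -
    have "norm (\<phi> x - \<phi> y) \<le> M * norm (x - y)"
    proof (rule differentiable_bound[of UNIV])
      show "(\<phi> has_derivative (\<lambda>h. h \<bullet> D z)) (at z within UNIV)" for z
        using dphi[of z] by (simp add: gderiv_def)
      show "onorm (\<lambda>h. h \<bullet> D z) \<le> M" for z
        by (rule onorm_le) (metis bound Cauchy_Schwarz_ineq2 mult.commute mult_left_mono
            norm_ge_zero order_trans real_norm_def)
    qed auto
    then show ?thesis by simp
  qed
  obtain R where R: "K \<subseteq> cball 0 R"
    using bounded_subset_ballD[OF compact_imp_bounded[OF K]] ball_subset_cball by (metis subset_trans)
  \<comment> \<open>The bound 1 keeps shifted points within distance 1, so that all supports stay in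
    \<open>cball 0 (R+1)\<close>; the bound \<open>h0 / 2\<close> makes \<open>second\<close>
    applicable.\<close>
  define h where "h k = min 1 (h0 / 2) / real (Suc k)" for k
  have hpos: "0 < h k" for k using h0 by (simp add: h_def)
  have hle: "h k \<le> min 1 (h0/2)" for k
    using h0 by (auto simp: h_def divide_le_eq min_def algebra_simps)
  have h1: "h k \<le> 1" and hh: "h k < h0" for k using hle[of k] h0 by auto
  have hlim: "h \<longlonglongrightarrow> 0"
    unfolding h_def by (rule tendsto_divide_0[OF tendsto_const])
       (intro filterlim_at_top_imp_at_infinity filterlim_compose[OF filterlim_real_sequentially filterlim_Suc])
  \<comment> \<open>Product of two forward difference quotients. Summation by parts, done by
    translating the term with \<open>\<phi> (x + h k *\<^sub>R e)\<close>, turns its integral into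
    that of minus the second difference of \<open>f\<close> times \<open>\<phi>\<close>, divided by
    \<open>(h k)\<^sup>2\<close>.\<close>
  define q where "q k x = (f (x + h k *\<^sub>R e) - f x) / h k * ((\<phi> (x + h k *\<^sub>R e) - \<phi> x) / h k)" for k x
  have int\<phi>: "integrable lborel (\<lambda>x. g x * \<phi> x)" if "continuous_on UNIV g" for g :: "'a \<Rightarrow> real"
    by (rule integrable_compact_support[OF K])
       (auto intro!: continuous_intros contphi continuous_on_subset[OF that] simp: supp)
  have q_int: "\<bar>\<integral>x. q k x \<partial>lborel\<bar> \<le> c * (\<integral>x. \<phi> x \<partial>lborel)" for k
  proof -
    let ?h = "h k *\<^sub>R e"
    let ?F = "\<lambda>x. (f x - f (x - ?h)) * \<phi> x"
    let ?G = "\<lambda>x. (f (x + ?h) - f x) * \<phi> x"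
    have cf: "continuous_on UNIV (\<lambda>x. f (x + v))" "continuous_on UNIV (\<lambda>x. f (x - v))" for v
      by (rule continuous_on_compose2[OF contf[of UNIV]]; auto intro!: continuous_intros)+
    have iF: "integrable lborel ?F" and iG: "integrable lborel ?G"
      by (intro int\<phi> continuous_intros cf contf)+
    have iF': "integrable lborel (\<lambda>x. ?F (x + ?h))"
    proof (rule integrable_compact_support[where K = "(\<lambda>x. x - ?h) ` K"])
      show "compact ((\<lambda>x. x - ?h) ` K)"
        using compact_translation[OF K, of "- ?h"] by simp
      show "continuous_on ((\<lambda>x. x - h k *\<^sub>R e) ` K) (\<lambda>x. (f (x + h k *\<^sub>R e) - f (x + h k *\<^sub>R e - h k *\<^sub>R e)) * \<phi> (x + h k *\<^sub>R e))"
        by (intro continuous_intros continuous_on_compose2[OF contf[of UNIV]]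
            continuous_on_compose2[OF contphi[of UNIV]]) auto
      fix x assume "x \<notin> (\<lambda>x. x - ?h) ` K"
      then have "x + ?h \<notin> K" by (metis add_diff_cancel_right' imageI)
      then show "(f (x + ?h) - f (x + ?h - ?h)) * \<phi> (x + ?h) = 0" by (simp add: supp)
    qed
    have "(\<integral>x. q k x \<partial>lborel) = (\<integral>x. (?F (x + ?h) - ?G x) / (h k)\<^sup>2 \<partial>lborel)"
      by (intro Bochner_Integration.integral_cong) (auto simp: q_def power2_eq_square field_simps)
    also have "\<dots> = ((\<integral>x. ?F (x + ?h) \<partial>lborel) - (\<integral>x. ?G x \<partial>lborel)) / (h k)\<^sup>2"
      using iF' iG by simp
    also have "(\<integral>x. ?F (x + ?h) \<partial>lborel) = (\<integral>x. ?F x \<partial>lborel)"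
      using borel_measurable_integrable[OF iF] by (intro lborel_integral_translate) simp
    also have "(\<integral>x. ?F x \<partial>lborel) - (\<integral>x. ?G x \<partial>lborel) = (\<integral>x. ?F x - ?G x \<partial>lborel)"
      using iF iG by simp
    finally have eq: "(\<integral>x. q k x \<partial>lborel) = (\<integral>x. ?F x - ?G x \<partial>lborel) / (h k)\<^sup>2" .
    have "\<bar>\<integral>x. ?F x - ?G x \<partial>lborel\<bar> \<le> (\<integral>x. c * (h k)\<^sup>2 * \<phi> x \<partial>lborel)"
    proof (rule order_trans[OF integral_abs_bound integral_mono])
      show "integrable lborel (\<lambda>x. \<bar>?F x - ?G x\<bar>)"
        using iF iG by (intro integrable_abs) simp
      show "integrable lborel (\<lambda>x. c * (h k)\<^sup>2 * \<phi> x)"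
        by (intro int\<phi> continuous_intros)
      fix x
      show "\<bar>?F x - ?G x\<bar> \<le> c * (h k)\<^sup>2 * \<phi> x"
      proof (cases "x \<in> K")
        case True
        have eq: "?F x - ?G x = - (f (x + ?h) + f (x - ?h) - 2 * f x) * \<phi> x"
          by (simp add: algebra_simps)
        have "\<bar>?F x - ?G x\<bar> = \<bar>f (x + ?h) + f (x - ?h) - 2 * f x\<bar> * \<phi> x"
          using nonneg[of x] unfolding eq by (simp add: abs_mult abs_minus_commute)
        also have "\<dots> \<le> c * (h k)\<^sup>2 * \<phi> x"
          by (intro mult_right_mono second True hpos hh nonneg)
        finally show ?thesis .
      qed (simp add: supp)
    qed
    then show ?thesis
      using hpos[of k] unfolding eq
      by (simp add: abs_divide pos_divide_le_eq mult.assoc mult.commute[of "(h k)\<^sup>2"])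
  qed
  have q_lim: "(\<lambda>k. q k x) \<longlonglongrightarrow> (\<nu> x \<bullet> e) * (D x \<bullet> e)" for x
  proof (cases "x \<in> K")
    case True
    show ?thesis unfolding q_def
      by (intro tendsto_mult gderiv_difference_quotient df dphi hlim hpos True)
  next
    case False
    have lim: "(\<lambda>k. (\<phi> (x + h k *\<^sub>R e) - \<phi> x) / h k) \<longlonglongrightarrow> 0"
      using gderiv_difference_quotient[OF dphi hlim hpos, of x e] D0[OF False] by simp
    \<comment> \<open>Off \<open>K\<close> nothing is known about the gradient of \<open>f\<close>,
      but its quotients are bounded by 1 while those of \<open>\<phi>\<close> tend to 0.\<close>
    have "(\<lambda>k. q k x) \<longlonglongrightarrow> 0"
    proof (rule Lim_null_comparison[OF _ tendsto_norm_zero[OF lim]], rule always_eventually, rule allI)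
      fix k
      have "\<bar>(f (x + h k *\<^sub>R e) - f x) / h k\<bar> \<le> 1"
        using lip[of "x + h k *\<^sub>R e" x] hpos[of k] ne by (simp add: dist_norm)
      then show "norm (q k x) \<le> norm ((\<phi> (x + h k *\<^sub>R e) - \<phi> x) / h k)"
        unfolding q_def norm_mult by (intro mult_left_le_one_le) auto
    qed
    then show ?thesis using D0[OF False] by simp
  qed
  have meas: "q k \<in> borel_measurable lborel" for k
  proof -
    have "continuous_on UNIV (q k)"
      unfolding q_def using hpos[of k]
      by (intro continuous_intros continuous_on_compose2[OF contf[of UNIV]]
            continuous_on_compose2[OF contphi[of UNIV]]) auto
    then show ?thesis by (simp add: borel_measurable_continuous_onI)
  qed
  have w_int: "integrable lborel (\<lambda>x. M * indicator (cball 0 (R+1)) x :: real)"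
    by (intro integrable_mult_right integrable_real_indicator emeasure_lborel_cball_finite) simp
  have dom: "norm (q k x) \<le> M * indicator (cball 0 (R+1)) x" for k x
  proof (cases "x \<in> cball 0 (R+1)")
    case True
    have 1: "\<bar>(f (x + h k *\<^sub>R e) - f x) / h k\<bar> \<le> 1"
      using lip[of "x + h k *\<^sub>R e" x] hpos[of k] ne by (simp add: dist_norm)
    have 2: "\<bar>(\<phi> (x + h k *\<^sub>R e) - \<phi> x) / h k\<bar> \<le> M"
      using lipphi[of "x + h k *\<^sub>R e" x] hpos[of k] ne by (simp add: field_simps)
    show ?thesis
      using mult_mono[OF 1 2] True by (simp add: q_def abs_mult)
  next
    case False
    then have nx: "norm x > R + 1" by simp
    have "norm (x + h k *\<^sub>R e) \<ge> norm x - h k"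
      using norm_diff_ineq[of x "h k *\<^sub>R e"] hpos[of k] ne by simp
    with nx h1[of k] have "x \<notin> K" "x + h k *\<^sub>R e \<notin> K"
      using R by auto
    then show ?thesis using M0 by (simp add: q_def supp)
  qed
  note dct = integral_dominated_convergence[where w = "\<lambda>x. M * indicator (cball 0 (R+1)) x"
      and f = "\<lambda>x. (\<nu> x \<bullet> e) * (D x \<bullet> e)" and s = q, OF _ meas w_int AE_I2[OF q_lim] AE_I2[OF dom]]
  have limmeas: "(\<lambda>x. (\<nu> x \<bullet> e) * (D x \<bullet> e)) \<in> borel_measurable lborel"
    by (rule borel_measurable_LIMSEQ_real[OF q_lim meas])
  show "integrable lborel (\<lambda>x. (\<nu> x \<bullet> e) * (D x \<bullet> e))"
    using integrable_dominated_convergence[where w = "\<lambda>x. M * indicator (cball 0 (R+1)) x"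
      and f = "\<lambda>x. (\<nu> x \<bullet> e) * (D x \<bullet> e)" and s = q, OF limmeas meas w_int AE_I2[OF q_lim] AE_I2[OF dom]] .
  from dct(1)[OF limmeas] have "(\<lambda>k. \<bar>\<integral>x. q k x \<partial>lborel\<bar>) \<longlonglongrightarrow> \<bar>\<integral>x. (\<nu> x \<bullet> e) * (D x \<bullet> e) \<partial>lborel\<bar>"
    by (rule tendsto_rabs)
  then show "\<bar>\<integral>x. (\<nu> x \<bullet> e) * (D x \<bullet> e) \<partial>lborel\<bar> \<le> c * (\<integral>x. \<phi> x \<partial>lborel)"
    by (rule LIMSEQ_le_const2) (use q_int in auto)
qed

section \<open>Tangent balls and the distance to the boundary\<close>

text \<open>The inequality between arithmetic and geometric mean for \<open>norm a\<close> and
  \<open>norm (a + v)\<close>: the norm lies below a paraboloid touching it at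
  \<open>a\<close>.\<close>

lemma norm_le_quadratic:
  fixes a v :: "'a::real_inner"
  assumes "a \<noteq> 0"
  shows "norm (a + v) \<le> norm a + (a \<bullet> v) / norm a + (norm v)\<^sup>2 / (2 * norm a)"
proof -
  have "norm a > 0" using assms by simp
  have "2 * norm a * norm (a + v) \<le> (norm a)\<^sup>2 + (norm (a + v))\<^sup>2"
    using sum_squares_bound[of "norm a" "norm (a + v)"] by simp
  also have "(norm (a + v))\<^sup>2 = (norm a)\<^sup>2 + 2 * (a \<bullet> v) + (norm v)\<^sup>2"
    by (simp add: power2_norm_eq_inner inner_add inner_commute)
  finally show ?thesis
    using \<open>norm a > 0\<close> by (simp add: field_simps power2_eq_square)
qed

text \<open>Disjoint open balls of the same radius \<open>u\<close> have centres at distance at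
  least \<open>2 * u\<close>, since otherwise the midpoint lies in both. As \<open>p\<close> is on
  both spheres, the triangle inequality through \<open>p\<close> is an equality, which makes
  \<open>p\<close> the midpoint of \<open>y\<close> and \<open>y'\<close>.\<close>

lemma frontier_ball_tangent:
  fixes \<Omega> :: "(real^'d) set"
  assumes "open \<Omega>" "p \<in> frontier \<Omega>" "u > 0"
    and "y \<in> \<Omega>" "cball y u \<inter> - \<Omega> = {p}"
    and "y' \<in> - \<Omega>" "cball y' u \<inter> closure \<Omega> = {p}"
  shows "dist p y = u" "dist p y' = u" "ball y u \<subseteq> \<Omega>" "ball y' u \<inter> closure \<Omega> = {}" "y - p = p - y'"
proof -
  have pc: "p \<in> closure \<Omega>" "p \<notin> \<Omega>"
    using assms(1,2) by (auto simp: frontier_def interior_open)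
  have "p \<in> cball y' u" "p \<in> cball y u" using assms by auto
  have "p \<notin> ball y' u"
  proof
    assume "p \<in> ball y' u"
    then have "ball y' u \<inter> \<Omega> \<noteq> {}"
      using pc(1) by (meson disjoint_iff open_Int_closure_eq_empty open_ball)
    moreover have "ball y' u \<inter> \<Omega> \<subseteq> {p}"
      using assms(7) closure_subset[of \<Omega>] ball_subset_cball[of y' u] by blast
    ultimately show False using pc(2) by blast
  qed
  then show d': "dist p y' = u"
    using \<open>p \<in> cball y' u\<close> by (auto simp: dist_commute)
  then show b': "ball y' u \<inter> closure \<Omega> = {}"
    using assms(7) ball_subset_cball[of y' u] by (fastforce simp: dist_commute)
  \<comment> \<open>\<open>p\<close> is a limit of points of the outer ball, so an open inner ball
    containing \<open>p\<close> would meet the outer one, which avoids the closure of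
    \<Omega>.\<close>
  have "p \<notin> ball y u"
  proof
    assume "p \<in> ball y u"
    moreover have "p \<in> closure (ball y' u)"
      using d' \<open>u > 0\<close> by (simp add: dist_commute)
    ultimately have "ball y u \<inter> ball y' u \<noteq> {}"
      by (meson disjoint_iff open_Int_closure_eq_empty open_ball)
    then obtain z where z: "z \<in> ball y u" "z \<in> ball y' u" by blast
    then have "z \<in> \<Omega> \<or> z = p" using assms(5) ball_subset_cball[of y u] by blast
    then show False using z b' pc closure_subset[of \<Omega>] by blast
  qed
  then show d: "dist p y = u"
    using \<open>p \<in> cball y u\<close> by (auto simp: dist_commute)
  then show b: "ball y u \<subseteq> \<Omega>"
    using assms(5) ball_subset_cball[of y u] by (fastforce simp: dist_commute)
  have disj: "ball y u \<inter> ball y' u = {}"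
    using b b' closure_subset[of \<Omega>] by blast
  have "u + u \<le> dist y y'"
  proof (rule ccontr)
    assume "\<not> u + u \<le> dist y y'"
    then have "midpoint y y' \<in> ball y u \<inter> ball y' u"
      by (simp add: dist_midpoint)
    then show False using disj by blast
  qed
  then have "norm ((y - p) + (p - y')) = norm (y - p) + norm (p - y')"
    using d d' norm_triangle_ineq[of "y - p" "p - y'"] by (simp add: dist_norm norm_minus_commute)
  then show "y - p = p - y'"
    using d d' \<open>u > 0\<close> unfolding norm_triangle_eq by (simp add: dist_norm norm_minus_commute)
qed

text \<open>The ball centred at \<open>y\<close> touches the boundary from inside at a nearest point of \<open>x\<close>, the one
  at \<open>y'\<close> from outside; they squeeze the distance function between two smooth functions that
  agree with it at \<open>x\<close>.\<close>

lemma bdry_dist_squeeze: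
  fixes \<Omega> :: "(real^'d) set"
  assumes "open \<Omega>" "frontier \<Omega> \<noteq> {}" "u > 0"
    and balls: "\<And>p. p \<in> frontier \<Omega> \<Longrightarrow>
        (\<exists>y\<in>\<Omega>. cball y u \<inter> - \<Omega> = {p}) \<and> (\<exists>y'\<in>- \<Omega>. cball y' u \<inter> closure \<Omega> = {p})"
    and x: "x \<in> \<Omega>" "bdry_dist \<Omega> x < u"
  obtains y y' where "dist x y = u - bdry_dist \<Omega> x" "dist x y' = u + bdry_dist \<Omega> x"
    "(u - bdry_dist \<Omega> x) *\<^sub>R (x - y') = - (u + bdry_dist \<Omega> x) *\<^sub>R (x - y)"
    "\<And>z. z \<in> \<Omega> \<Longrightarrow> u - dist z y \<le> bdry_dist \<Omega> z"
    "\<And>z. z \<in> \<Omega> \<Longrightarrow> bdry_dist \<Omega> z \<le> dist z y' - u"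
proof -
  let ?d = "bdry_dist \<Omega>"
  obtain p where p: "p \<in> frontier \<Omega>" "?d x = dist x p"
    unfolding bdry_dist_def using infdist_attains_inf[OF frontier_closed assms(2)] by metis
  obtain y y' where y: "y \<in> \<Omega>" "cball y u \<inter> - \<Omega> = {p}" and y': "y' \<in> - \<Omega>" "cball y' u \<inter> closure \<Omega> = {p}"
    using balls[OF p(1)] by blast
  note t = frontier_ball_tangent[OF assms(1) p(1) assms(3) y y']
  have lower: "u - dist z y \<le> ?d z" for z
    unfolding bdry_dist_def infdist_notempty[OF assms(2)]
  proof (rule cINF_greatest[OF assms(2)])
    fix w assume "w \<in> frontier \<Omega>"
    then have "w \<notin> \<Omega>" using assms(1) by (simp add: frontier_def interior_open)
    then have "w \<notin> ball y u" using t(3) by blast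
    then have "u \<le> dist y w" by simp
    then show "u - dist z y \<le> dist z w"
      using dist_triangle[of y w z] by (simp add: dist_commute)
  qed
  have upper: "?d z \<le> dist z y' - u" if "z \<in> \<Omega>" for z
  proof -
    \<comment> \<open>The segment from \<open>z\<close> to the outer centre crosses the frontier at
      a point that is still outside the open outer ball, so the rest of it has length at least
      \<open>u\<close>.\<close>
    have "closed_segment z y' \<inter> frontier \<Omega> \<noteq> {}"
      using that y'(1) by (intro connected_Int_frontier) auto
    then obtain w where w: "w \<in> closed_segment z y'" "w \<in> frontier \<Omega>" by blast
    then have "w \<notin> ball y' u" using t(4) by (auto simp: frontier_def)
    then have "u \<le> dist y' w" by simp
    moreover have "dist z w + dist w y' = dist z y'"
      using w(1) by (simp add: between_mem_segment[symmetric] between)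
    moreover have "?d z \<le> dist z w"
      unfolding bdry_dist_def by (rule infdist_le[OF w(2)])
    ultimately show ?thesis by (simp add: dist_commute)
  qed
  have dxy': "dist x y' = u + ?d x"
    using upper[OF x(1)] dist_triangle[of x y' p] t(2) p(2) by (simp add: dist_commute)
  \<comment> \<open>Equality in the triangle inequality puts \<open>x\<close> on the ray from
    \<open>y'\<close> through \<open>p\<close>; hence \<open>x\<close>, \<open>y\<close> and
    \<open>y'\<close> are collinear.\<close>
  have "norm ((x - p) + (p - y')) = norm (x - p) + norm (p - y')"
    using dxy' p(2) t(2) by (simp add: dist_norm)
  then have "norm (x - p) *\<^sub>R (p - y') = norm (p - y') *\<^sub>R (x - p)"
    unfolding norm_triangle_eq .
  then have eq: "?d x *\<^sub>R (p - y') = u *\<^sub>R (x - p)"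
    using p(2) t(2) by (simp add: dist_norm)
  then have xp: "x = p + (?d x / u) *\<^sub>R (p - y')"
  proof -
    have "(?d x / u) *\<^sub>R (p - y') = (1 / u) *\<^sub>R (?d x *\<^sub>R (p - y'))" by simp
    also have "\<dots> = x - p" unfolding eq using \<open>u > 0\<close> by simp
    finally show ?thesis by simp
  qed
  have xy': "x - y' = (1 + ?d x / u) *\<^sub>R (p - y')"
    by (subst xp) (simp add: algebra_simps)
  have xy: "x - y = - (1 - ?d x / u) *\<^sub>R (p - y')"
    using t(5) by (subst xp) (simp add: algebra_simps)
  show thesis
  proof
    have "dist x y = \<bar>1 - ?d x / u\<bar> * u"
      unfolding dist_norm xy using t(2) by (simp add: dist_norm abs_minus_commute)
    also have "\<bar>1 - ?d x / u\<bar> = 1 - ?d x / u"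
      using x(2) \<open>u > 0\<close> by simp
    finally show "dist x y = u - ?d x"
      using \<open>u > 0\<close> by (simp add: left_diff_distrib)
    show "dist x y' = u + ?d x" by (rule dxy')
    show "(u - ?d x) *\<^sub>R (x - y') = - (u + ?d x) *\<^sub>R (x - y)"
    proof -
      have "(u - ?d x) * (1 + ?d x / u) = - (u + ?d x) * - (1 - ?d x / u)"
        using \<open>u > 0\<close> by (simp add: field_simps)
      then show ?thesis unfolding xy xy' scaleR_scaleR by (simp only:)
    qed
  qed (use lower upper in auto)
qed

text \<open>On the layer of width \<open>u/2\<close> the distances \<open>u - d x\<close> and
  \<open>u + d x\<close> to the two centres are at least \<open>u/2\<close>, so
  \<open>norm_le_quadratic\<close> applied to both squeezing functions leaves an error of at most
  \<open>(norm (z - x))\<^sup>2 / u\<close>. Their linear terms agree by the collinearity in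
  \<open>bdry_dist_squeeze\<close>.\<close>

lemma bdry_dist_quadratic:
  fixes \<Omega> :: "(real^'d) set"
  assumes "C11_domain \<Omega>" "frontier \<Omega> \<noteq> {}"
  obtains \<rho> c \<nu> where "\<rho> > 0" "c > 0"
    "\<And>x. x \<in> bdry_layer \<Omega> \<rho> \<Longrightarrow> norm (\<nu> x) = 1"
    "\<And>x z. x \<in> bdry_layer \<Omega> \<rho> \<Longrightarrow> z \<in> \<Omega> \<Longrightarrow>
       \<bar>bdry_dist \<Omega> z - bdry_dist \<Omega> x - \<nu> x \<bullet> (z - x)\<bar> \<le> c * (norm (z - x))\<^sup>2"
proof -
  let ?d = "bdry_dist \<Omega>"
  have op: "open \<Omega>" using assms by (simp add: C11_domain_def)
  obtain u where u: "u > 0" and balls: "\<And>p. p \<in> frontier \<Omega> \<Longrightarrow>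
        (\<exists>y\<in>\<Omega>. cball y u \<inter> - \<Omega> = {p}) \<and> (\<exists>y'\<in>- \<Omega>. cball y' u \<inter> closure \<Omega> = {p})"
    using assms(1) unfolding C11_domain_def by blast
  have "\<exists>n. norm n = 1 \<and> (\<forall>z\<in>\<Omega>. \<bar>?d z - ?d x - n \<bullet> (z - x)\<bar> \<le> (1/u) * (norm (z - x))\<^sup>2)"
    if xl: "x \<in> bdry_layer \<Omega> (u/2)" for x
  proof -
    have x: "x \<in> \<Omega>" "?d x < u" and x2: "?d x < u/2" using xl u by (auto simp: bdry_layer_def)
    have d0: "0 \<le> ?d x" by (simp add: bdry_dist_def infdist_nonneg)
    obtain y y' where y: "dist x y = u - ?d x" "dist x y' = u + ?d x"
      and yy: "(u - ?d x) *\<^sub>R (x - y') = - (u + ?d x) *\<^sub>R (x - y)"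
      and low: "\<And>z. z \<in> \<Omega> \<Longrightarrow> u - dist z y \<le> ?d z"
      and up: "\<And>z. z \<in> \<Omega> \<Longrightarrow> ?d z \<le> dist z y' - u"
      using bdry_dist_squeeze[OF op assms(2) u balls x] by metis
    have n: "norm (x - y) = u - ?d x" "norm (x - y') = u + ?d x"
      using y by (simp_all add: dist_norm)
    \<comment> \<open>The unit vector from the outer centre to \<open>x\<close>: the gradient at
      \<open>x\<close> of both squeezing functions.\<close>
    define v where "v = (1 / (u + ?d x)) *\<^sub>R (x - y')"
    have v1: "norm v = 1" using n d0 u by (simp add: v_def)
    have xy': "x - y' = (u + ?d x) *\<^sub>R v" using d0 u by (simp add: v_def)
    have "(u + ?d x) *\<^sub>R ((u - ?d x) *\<^sub>R v) = (u + ?d x) *\<^sub>R (- (x - y))"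
      using yy unfolding xy' by (metis mult.commute scaleR_minus_left scaleR_minus_right scaleR_scaleR)
    moreover have "u + ?d x \<noteq> 0" using d0 u by simp
    ultimately have "(u - ?d x) *\<^sub>R v = - (x - y)"
      by (simp only: scaleR_cancel_left simp_thms)
    then have xy: "x - y = - (u - ?d x) *\<^sub>R v"
      by (metis minus_minus scaleR_minus_left)
    have "\<bar>?d z - ?d x - v \<bullet> (z - x)\<bar> \<le> (1/u) * (norm (z - x))\<^sup>2" if "z \<in> \<Omega>" for z
    proof -
      have ne: "x - y' \<noteq> 0" "x - y \<noteq> 0" using n x d0 u by auto
      have bnd: "(norm (z - x))\<^sup>2 / (2 * s) \<le> (1/u) * (norm (z - x))\<^sup>2" if "s \<ge> u/2" for s
      proof -
        have "(norm (z - x))\<^sup>2 / (2 * s) \<le> (norm (z - x))\<^sup>2 / u"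
          using that u by (intro divide_left_mono) auto
        then show ?thesis by simp
      qed
      have "(x - y') \<bullet> (z - x) / (u + ?d x) = v \<bullet> (z - x)"
        unfolding xy' using d0 u by simp
      then have "dist z y' \<le> u + ?d x + v \<bullet> (z - x) + (norm (z - x))\<^sup>2 / (2 * (u + ?d x))"
        using norm_le_quadratic[OF ne(1), of "z - x"] unfolding n dist_norm by simp
      moreover have "(x - y) \<bullet> (z - x) / (u - ?d x) = - (v \<bullet> (z - x))"
      proof -
        have "(x - y) \<bullet> (z - x) = - (v \<bullet> (z - x)) * (u - ?d x)"
          unfolding xy by (simp add: left_diff_distrib right_diff_distrib mult.commute)
        then show ?thesis using x by simp
      qed
      then have "dist z y \<le> u - ?d x - v \<bullet> (z - x) + (norm (z - x))\<^sup>2 / (2 * (u - ?d x))"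
        using norm_le_quadratic[OF ne(2), of "z - x"] unfolding n dist_norm by simp
      ultimately show ?thesis
        using low[OF that] up[OF that] bnd[of "u + ?d x"] bnd[of "u - ?d x"] d0 x2 u by linarith
    qed
    then show ?thesis using v1 by blast
  qed
  then obtain \<nu> where "\<And>x. x \<in> bdry_layer \<Omega> (u/2) \<Longrightarrow> norm (\<nu> x) = 1 \<and>
     (\<forall>z\<in>\<Omega>. \<bar>?d z - ?d x - \<nu> x \<bullet> (z - x)\<bar> \<le> (1/u) * (norm (z - x))\<^sup>2)"
    by metis
  then show thesis
    using u by (intro that[of "u/2" "1/u" \<nu>]) auto
qed

section \<open>The regular layer\<close>

lemma gderiv_unique:
  assumes "GDERIV f x :> D" "GDERIV f x :> D'"
  shows "D = D'"
proof -
  have "(\<lambda>h. h \<bullet> D) = (\<lambda>h. h \<bullet> D')"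
    using assms unfolding gderiv_def by (rule has_derivative_unique)
  then have "(D - D') \<bullet> D = (D - D') \<bullet> D'" by metis
  then have "(D - D') \<bullet> (D - D') = 0" by (simp add: inner_diff_right)
  then show ?thesis by simp
qed

lemma grad_eq: "GDERIV f x :> D \<Longrightarrow> grad f x = D"
  unfolding grad_def by (blast intro: gderiv_unique)

text \<open>The support is a compact subset of \<open>W\<close>, so the extension by zero is
  differentiable on the whole space.\<close>

lemma C1cE:
  assumes "\<psi> \<in> C1c W"
  obtains K where "compact K" "K \<subseteq> W" "\<And>x. x \<notin> K \<Longrightarrow> \<psi> x = 0" "\<And>x. x \<notin> K \<Longrightarrow> grad \<psi> x = 0"
    "\<And>x. GDERIV \<psi> x :> grad \<psi> x" "continuous_on W (grad \<psi>)" "continuous_on UNIV \<psi>"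
proof -
  define K where "K = closure {x. \<psi> x \<noteq> 0}"
  have K: "compact K" "K \<subseteq> W" and cont: "continuous_on W (grad \<psi>)"
    and d: "\<And>x. x \<in> W \<Longrightarrow> \<exists>D. GDERIV \<psi> x :> D"
    using assms by (auto simp: C1c_def K_def)
  have z: "\<psi> x = 0" if "x \<notin> K" for x
    using that closure_subset[of "{x. \<psi> x \<noteq> 0}"] unfolding K_def by blast
  have gz: "GDERIV \<psi> x :> 0" if "x \<notin> K" for x
    by (rule gderiv_zero_outside[OF compact_imp_closed[OF K(1)] z that])
  have g: "GDERIV \<psi> x :> grad \<psi> x" for x
    using d[of x] gz[of x] K(2) grad_eq by (metis subsetD)
  have "continuous_on UNIV \<psi>"
    by (rule continuous_at_imp_continuous_on)
       (use g in \<open>auto simp: gderiv_def dest!: has_derivative_continuous\<close>)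
  with K cont z grad_eq[OF gz] g show thesis by (intro that)
qed

lemma bdry_dist_pos:
  assumes "open \<Omega>" "frontier \<Omega> \<noteq> {}" "x \<in> \<Omega>"
  shows "0 < bdry_dist \<Omega> x"
proof -
  have "x \<notin> frontier \<Omega>" using assms by (simp add: frontier_def interior_open)
  then show ?thesis
    unfolding bdry_dist_def using infdist_pos_not_in_closed[OF frontier_closed assms(2)] by blast
qed

lemma continuous_on_bdry_dist: "continuous_on S (bdry_dist \<Omega>)"
  unfolding bdry_dist_def by (intro continuous_intros)

lemma open_bdry_layer:
  assumes "open \<Omega>"
  shows "open (bdry_layer \<Omega> r)"
proof -
  have "bdry_layer \<Omega> r = \<Omega> \<inter> {x. bdry_dist \<Omega> x < r}"
    by (auto simp: bdry_layer_def)
  then show ?thesis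
    using assms by (simp add: open_Int open_Collect_less continuous_on_bdry_dist)
qed

text \<open>What the estimates retain of the ball conditions: a quadratic expansion of the distance
  with a uniform constant and unit gradient \<open>\<nu>\<close>. The point \<open>z\<close> ranges
  over all of \<Omega>, so difference steps may leave the layer as long as they stay in
  \<Omega>.\<close>

locale regular_layer =
  fixes \<Omega> :: "(real^'d) set" and \<rho> c :: real and \<nu> :: "real^'d \<Rightarrow> real^'d"
  assumes open_domain: "open \<Omega>" and frontier_nonempty: "frontier \<Omega> \<noteq> {}"
    and c_pos: "c > 0"
    and norm_normal: "x \<in> bdry_layer \<Omega> \<rho> \<Longrightarrow> norm (\<nu> x) = 1"
    and quadratic: "x \<in> bdry_layer \<Omega> \<rho> \<Longrightarrow> z \<in> \<Omega> \<Longrightarrow>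
       \<bar>bdry_dist \<Omega> z - bdry_dist \<Omega> x - \<nu> x \<bullet> (z - x)\<bar> \<le> c * (norm (z - x))\<^sup>2"
begin

abbreviation "d \<equiv> bdry_dist \<Omega>"
abbreviation "W \<equiv> bdry_layer \<Omega> \<rho>"
text \<open>Bound for the distributional Laplacian of the distance on the layer:
  \<open>2 * c\<close> for each coordinate direction.\<close>

definition "\<kappa> = 2 * c * DIM(real^'d)"

lemma W_subset: "x \<in> W \<Longrightarrow> x \<in> \<Omega>"
  by (simp add: bdry_layer_def)

lemma d_pos: "x \<in> \<Omega> \<Longrightarrow> 0 < d x"
  by (rule bdry_dist_pos[OF open_domain frontier_nonempty])

lemma open_W: "open W"
  by (rule open_bdry_layer[OF open_domain])

lemma \<kappa>_pos: "\<kappa> > 0"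
  using c_pos by (simp add: \<kappa>_def)

lemma gderiv_d:
  assumes "x \<in> W"
  shows "GDERIV d x :> \<nu> x"
proof -
  obtain e where e: "e > 0" "ball x e \<subseteq> \<Omega>"
    using open_domain W_subset[OF assms] open_contains_ball by blast
  show ?thesis
    unfolding gderiv_def
  proof (rule has_derivativeI_sandwich[OF e(1), where H = "\<lambda>y. c * norm (y - x)"])
    show "bounded_linear (\<lambda>h. h \<bullet> \<nu> x)" by (rule bounded_linear_inner_left)
    show "((\<lambda>y. c * norm (y - x)) \<longlongrightarrow> 0) (at x)"
      by (auto intro!: tendsto_eq_intros)
    fix y assume y: "y \<noteq> x" "dist y x < e"
    then have "y \<in> \<Omega>" using e(2) by (auto simp: dist_commute)
    from quadratic[OF assms this]
    show "norm (d y - d x - (y - x) \<bullet> \<nu> x) / norm (y - x) \<le> c * norm (y - x)"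
      using y(1) by (simp add: inner_commute pos_divide_le_eq power2_eq_square mult.assoc)
  qed
qed

text \<open>Comparing the quadratic expansions at \<open>x\<close> and \<open>y\<close> along a common increment \<open>v\<close> shows that
  \<open>\<nu>\<close> is a locally uniform limit of difference quotients of the continuous function \<open>d\<close>.\<close>

lemma continuous_on_normal: "continuous_on W \<nu>"
  unfolding continuous_on_iff
proof (intro ballI allI impI)
  fix x and \<epsilon> :: real assume x: "x \<in> W" and \<epsilon>: "\<epsilon> > 0"
  obtain e where e: "e > 0" "ball x e \<subseteq> \<Omega>"
    using open_domain W_subset[OF x] open_contains_ball by blast
  \<comment> \<open>\<open>\<tau>\<close> is the length of the increment and \<open>r\<close> the
    admissible distance from \<open>y\<close> to \<open>x\<close>. The two expansions leave the
    error \<open>2 * (c * \<tau>\<^sup>2) + 2 * r\<close>, which has to be below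
    \<open>\<tau> * \<epsilon>\<close>; the bounds by \<open>e / 2\<close> keep \<open>x + v\<close>
    and \<open>y + v\<close> in \<Omega>.\<close>
  define \<tau> where "\<tau> = min (e / 2) (\<epsilon> / (4 * c))"
  have \<tau>: "0 < \<tau>" "\<tau> \<le> e / 2" "2 * c * \<tau> \<le> \<epsilon> / 2"
    using e \<epsilon> c_pos by (auto simp: \<tau>_def min_def field_simps)
  define r where "r = min (e / 2) (\<tau> * \<epsilon> / 8)"
  have r: "0 < r" "r \<le> e / 2" "2 * r \<le> \<tau> * \<epsilon> / 4"
    using e \<epsilon> \<tau> by (auto simp: r_def)
  show "\<exists>r>0. \<forall>y\<in>W. dist y x < r \<longrightarrow> dist (\<nu> y) (\<nu> x) < \<epsilon>"
  proof (intro exI[of _ r] conjI ballI impI)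
    fix y assume y: "y \<in> W" and dist: "dist y x < r"
    show "dist (\<nu> y) (\<nu> x) < \<epsilon>"
    proof (cases "\<nu> y = \<nu> x")
      case False
      define N where "N = norm (\<nu> y - \<nu> x)"
      have N: "N > 0" using False by (simp add: N_def)
      \<comment> \<open>The increment points along the difference of the normals, so that pairing it
        with this difference gives \<open>\<tau> * N\<close>.\<close>
      define v where "v = (\<tau> / N) *\<^sub>R (\<nu> y - \<nu> x)"
      have nv: "norm v = \<tau>" using N \<tau> by (simp add: v_def N_def[symmetric])
      have ip: "(\<nu> y - \<nu> x) \<bullet> v = \<tau> * N"
        using N by (simp add: v_def N_def[symmetric] power2_norm_eq_inner[symmetric] power2_eq_square)
      have "dist x (x + v) < e" "dist x (y + v) < e"
        using nv \<tau> e dist r dist_triangle[of x "y + v" y]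
        by (auto simp: dist_norm norm_minus_commute)
      then have "x + v \<in> \<Omega>" "y + v \<in> \<Omega>" using e(2) by auto
      from quadratic[OF x this(1)] quadratic[OF y this(2)]
      have "\<bar>d (x + v) - d x - \<nu> x \<bullet> v\<bar> \<le> c * \<tau>\<^sup>2" "\<bar>d (y + v) - d y - \<nu> y \<bullet> v\<bar> \<le> c * \<tau>\<^sup>2"
        by (simp_all add: nv)
      moreover have "\<bar>d (y + v) - d (x + v)\<bar> \<le> dist y x" "\<bar>d y - d x\<bar> \<le> dist y x"
        using infdist_triangle_abs[of "y + v" "frontier \<Omega>" "x + v"] infdist_triangle_abs[of y "frontier \<Omega>" x]
        by (simp_all add: bdry_dist_def dist_norm)
      ultimately have "(\<nu> y - \<nu> x) \<bullet> v \<le> 2 * (c * \<tau>\<^sup>2) + 2 * r"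
        using dist unfolding inner_diff_left by linarith
      also have "\<dots> \<le> \<tau> * (\<epsilon> / 2) + \<tau> * (\<epsilon> / 4)"
      proof -
        have "2 * (c * \<tau>\<^sup>2) = \<tau> * (2 * c * \<tau>)" by (simp add: power2_eq_square)
        also have "\<dots> \<le> \<tau> * (\<epsilon> / 2)" using \<tau> by (intro mult_left_mono) auto
        finally show ?thesis using r(3) by (simp add: mult.commute)
      qed
      also have "\<dots> < \<tau> * \<epsilon>" using \<tau>(1) \<epsilon> by (simp add: algebra_simps)
      finally have "N < \<epsilon>" unfolding ip using \<tau>(1) by simp
      then show ?thesis by (simp add: N_def dist_norm)
    qed (use \<epsilon> in simp)
  qed (rule r(1))
qed

text \<open>In a second difference of the distance the linear terms for the increments
  \<open>h *\<^sub>R e\<close> and \<open>- h *\<^sub>R e\<close> cancel, leaving at most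
  \<open>2 * c * h\<^sup>2\<close>. Summing \<open>second_difference_weak_bound\<close> over the
  coordinate directions gives \<open>\<kappa>\<close>.\<close>

lemma weak_laplacian_bound:
  assumes K: "compact K" "K \<subseteq> W"
    and nonneg: "\<And>x. 0 \<le> \<phi> x"
    and supp: "\<And>x. x \<notin> K \<Longrightarrow> \<phi> x = 0"
    and dphi: "\<And>x. GDERIV \<phi> x :> D x"
    and D: "continuous_on K D" "\<And>x. x \<notin> K \<Longrightarrow> D x = 0"
  shows "\<bar>\<integral>x. \<nu> x \<bullet> D x \<partial>lborel\<bar> \<le> \<kappa> * (\<integral>x. \<phi> x \<partial>lborel)"
proof -
  have "compact (D ` K)" using K(1) D(1) by (intro compact_continuous_image)
  then obtain M where M: "\<And>x. x \<in> K \<Longrightarrow> norm (D x) \<le> M"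
    using compact_imp_bounded bounded_iff by (metis imageI)
  have bound: "norm (D x) \<le> max M 0" for x
    using M[of x] D(2)[of x] by (cases "x \<in> K") auto
  have "K \<subseteq> \<Omega>" using K(2) W_subset by blast
  \<comment> \<open>Steps shorter than \<open>h0\<close> from points of \<open>K\<close> stay in
    \<Omega>, where the expansion is available.\<close>
  then obtain h0 where h0: "h0 > 0" "(\<Union>x\<in>K. cball x h0) \<subseteq> \<Omega>"
    using compact_subset_open_imp_cball_epsilon_subset[OF K(1) open_domain] by metis
  have second: "\<bar>d (x + h *\<^sub>R e) + d (x - h *\<^sub>R e) - 2 * d x\<bar> \<le> (2 * c) * h\<^sup>2"
    if "x \<in> K" "0 < h" "h < h0" "e \<in> Basis" for x h e
  proof -
    have ne: "norm e = 1" using that by simp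
    have "x + h *\<^sub>R e \<in> cball x h0" "x - h *\<^sub>R e \<in> cball x h0"
      using that ne by (auto simp: dist_norm)
    then have "x + h *\<^sub>R e \<in> \<Omega>" "x - h *\<^sub>R e \<in> \<Omega>" using h0(2) that(1) by blast+
    moreover have "x \<in> W" using that(1) K(2) by blast
    ultimately have "\<bar>d (x + h *\<^sub>R e) - d x - \<nu> x \<bullet> (h *\<^sub>R e)\<bar> \<le> c * h\<^sup>2"
        "\<bar>d (x - h *\<^sub>R e) - d x - \<nu> x \<bullet> (- h *\<^sub>R e)\<bar> \<le> c * h\<^sup>2"
      using quadratic[of x "x + h *\<^sub>R e"] quadratic[of x "x - h *\<^sub>R e"] ne that(2) by simp_all
    then show ?thesis by simp
  qed
  have lip: "\<bar>d x - d y\<bar> \<le> dist x y" for x y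
    unfolding bdry_dist_def by (rule infdist_triangle_abs)
  have dd: "GDERIV d x :> \<nu> x" if "x \<in> K" for x
    using gderiv_d K(2) that by blast
  note sd = second_difference_weak_bound[OF lip K(1) nonneg supp dd dphi bound _ h0(1) second]
  have "(\<integral>x. \<nu> x \<bullet> D x \<partial>lborel) = (\<Sum>e\<in>Basis. \<integral>x. (\<nu> x \<bullet> e) * (D x \<bullet> e) \<partial>lborel)"
    by (subst euclidean_inner, rule Bochner_Integration.integral_sum) (rule sd(1))
  also have "\<bar>\<dots>\<bar> \<le> (\<Sum>e\<in>(Basis :: (real^'d) set). 2 * c * (\<integral>x. \<phi> x \<partial>lborel))"
    by (rule order_trans[OF sum_abs]) (intro sum_mono sd(2))
  also have "\<dots> = \<kappa> * (\<integral>x. \<phi> x \<partial>lborel)"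
    by (simp add: \<kappa>_def)
  finally show ?thesis .
qed

end

section \<open>The Hardy inequality near the boundary\<close>

lemma L2_norm_compact_support:
  fixes f :: "real^'d \<Rightarrow> 'b::real_normed_vector"
  assumes "K \<subseteq> \<Omega>" "\<And>x. x \<notin> K \<Longrightarrow> f x = 0"
  shows "L2_norm \<Omega> f = sqrt (\<integral>x. (norm (f x))\<^sup>2 \<partial>lborel)"
proof -
  have "indicator \<Omega> x *\<^sub>R (norm (f x))\<^sup>2 = (norm (f x))\<^sup>2" for x
    using assms by (cases "x \<in> \<Omega>") auto
  then show ?thesis unfolding L2_norm_def set_lebesgue_integral_def by (simp only:)
qed

context regular_layer
begin

text \<open>Writing \<open>d x powr s / d x\<close> for the lowered power keeps the weight itself
  visible, so that later products combine by field arithmetic.\<close>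

lemma gderiv_d_powr:
  assumes "x \<in> W"
  shows "GDERIV (\<lambda>y. d y powr s) x :> (s * (d x powr s / d x)) *\<^sub>R \<nu> x"
proof -
  have "0 < d x" using assms by (intro d_pos W_subset)
  then have "DERIV (\<lambda>t. t powr s) (d x) :> s * (d x powr s / d x)"
    by (auto intro!: derivative_eq_intros simp: powr_diff)
  from GDERIV_DERIV_compose[OF gderiv_d[OF assms] this] show ?thesis by simp
qed

lemma d_powr_half: "x \<in> \<Omega> \<Longrightarrow> d x powr (\<delta> / 2) = d x powr (\<delta> / 2 - 1) * d x"
  using d_pos[of x] by (simp add: powr_diff)

lemma continuous_on_d_powr: "S \<subseteq> \<Omega> \<Longrightarrow> continuous_on S (\<lambda>x. d x powr s)"
  using d_pos by (intro continuous_intros continuous_on_bdry_dist) force+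

text \<open>The loss \<open>\<kappa> * r\<close> comes from the weak bound, as \<open>\<phi>\<close>
  is the squared left-hand integrand times the distance, which is below \<open>r\<close>. Young's
  inequality for the mixed term is tuned to absorb half of \<open>b * P\<close>, which yields the
  constant \<open>2 / b\<close>.\<close>

lemma hardy_on_layer:
  assumes r: "0 < r" "r \<le> \<rho>" and b: "b = \<bar>\<delta> - 1\<bar> - \<kappa> * r" "b > 0"
  shows "boundary_hardy \<Omega> \<delta> r (2 / b)"
  unfolding boundary_hardy_def
proof
  fix \<psi> assume \<psi>: "\<psi> \<in> C1c (bdry_layer \<Omega> r)"
  obtain K where K: "compact K" "K \<subseteq> bdry_layer \<Omega> r" and z: "\<And>x. x \<notin> K \<Longrightarrow> \<psi> x = 0" "\<And>x. x \<notin> K \<Longrightarrow> grad \<psi> x = 0"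
    and g: "\<And>x. GDERIV \<psi> x :> grad \<psi> x" and "continuous_on (bdry_layer \<Omega> r) (grad \<psi>)" "continuous_on UNIV \<psi>"
    using C1cE[OF \<psi>] by metis
  then have cont: "continuous_on K (grad \<psi>)" "continuous_on K \<psi>"
    using continuous_on_subset by blast+
  have KW: "K \<subseteq> W" using K(2) r(2) by (auto simp: bdry_layer_def)
  then have KO: "K \<subseteq> \<Omega>" using W_subset by blast
  \<comment> \<open>In terms of this weight \<open>A\<close> and \<open>B\<close> are the integrands
    of the two norms, \<open>\<phi>\<close> is \<open>d powr (\<delta> - 1)\<close> times the square
    of \<open>\<psi>\<close>, and \<open>D\<close> is the gradient of \<open>\<phi>\<close>.\<close>
  define w where "w x = d x powr (\<delta> / 2 - 1)" for x
  have dr: "0 < d x" "d x < r" if "x \<in> K" for x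
    using that K(2) KO d_pos by (auto simp: bdry_layer_def)
  have cw: "continuous_on K w"
    unfolding w_def by (rule continuous_on_d_powr[OF KO])
  note [continuous_intros] = cw cont continuous_on_bdry_dist continuous_on_subset[OF continuous_on_normal KW]
  define A where "A x = w x * \<psi> x" for x
  define B where "B x = (w x * d x) *\<^sub>R grad \<psi> x" for x
  define \<phi> where "\<phi> x = d x * (w x * w x) * (\<psi> x * \<psi> x)" for x
  define D where "D x = ((\<delta> - 1) * (A x)\<^sup>2) *\<^sub>R \<nu> x + (2 * A x * w x * d x) *\<^sub>R grad \<psi> x" for x
  have A0: "A x = 0" and B0: "B x = 0" and \<phi>0: "\<phi> x = 0" and D0: "D x = 0" if "x \<notin> K" for x
    using z that by (simp_all add: A_def B_def \<phi>_def D_def)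
  have d\<phi>: "GDERIV \<phi> x :> D x" for x
  proof (cases "x \<in> K")
    case True
    have x: "x \<in> W" "d x \<noteq> 0" using KW dr(1)[OF True] True by auto
    define k where "k = (\<delta> / 2 - 1) * (w x / d x)"
    have gw: "GDERIV w x :> k *\<^sub>R \<nu> x"
      unfolding w_def k_def by (rule gderiv_d_powr[OF x(1)])
    \<comment> \<open>Since \<open>d x * k = (\<delta> / 2 - 1) * w x\<close>, the derivatives of
      the two weights and of the factor \<open>d\<close> add up to
      \<open>(\<delta> - 1) * (w x * w x)\<close>.\<close>
    have 1: "(\<delta> - 1) * (A x)\<^sup>2 = \<psi> x * \<psi> x * (d x * (w x * k + w x * k) + w x * w x)"
      using x(2) by (simp add: A_def k_def power2_eq_square algebra_simps)
    show ?thesis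
      unfolding \<phi>_def
      by (rule GDERIV_subst[OF GDERIV_mult[OF GDERIV_mult[OF gderiv_d[OF x(1)] GDERIV_mult[OF gw gw]]
            GDERIV_mult[OF g g]]]) 
        (simp only: D_def 1 scaleR_2[symmetric] scaleR_add_right scaleR_scaleR scaleR_add_left[symmetric],
          subst add.commute, intro arg_cong2[where f = "(+)"] arg_cong2[where f = scaleR] refl;
          simp add: A_def algebra_simps)
  next
    case False
    then show ?thesis
      using gderiv_zero_outside[OF compact_imp_closed[OF K(1)] \<phi>0] D0 by simp
  qed
  have \<phi>nn: "0 \<le> \<phi> x" for x
    unfolding \<phi>_def by (simp add: bdry_dist_def infdist_nonneg)
  have cD: "continuous_on K D" and cA: "continuous_on K A" and cB: "continuous_on K B"
    and c\<phi>: "continuous_on K \<phi>"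
    unfolding D_def A_def B_def \<phi>_def by (intro continuous_intros)+
  note weak = weak_laplacian_bound[OF K(1) KW \<phi>nn \<phi>0 d\<phi> cD D0]
  have iA: "integrable lborel (\<lambda>x. (A x)\<^sup>2)"
    by (rule integrable_compact_support[OF K(1)]) (auto intro!: continuous_intros cA simp: A0)
  have iB: "integrable lborel (\<lambda>x. (norm (B x))\<^sup>2)"
    by (rule integrable_compact_support[OF K(1)]) (auto intro!: continuous_intros cB simp: B0)
  have i\<phi>: "integrable lborel \<phi>"
    by (rule integrable_compact_support[OF K(1) c\<phi> \<phi>0])
  have iD: "integrable lborel (\<lambda>x. \<nu> x \<bullet> D x)"
    by (rule integrable_compact_support[OF K(1)]) (auto intro!: continuous_intros cD simp: D0)
  define P where "P = (\<integral>x. (A x)\<^sup>2 \<partial>lborel)"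
  define Q where "Q = (\<integral>x. (norm (B x))\<^sup>2 \<partial>lborel)"
  have \<phi>le: "\<phi> x \<le> r * (A x)\<^sup>2" for x
  proof (cases "x \<in> K")
    case True
    have "\<phi> x = d x * (A x)\<^sup>2" by (simp add: \<phi>_def A_def power2_eq_square)
    also have "\<dots> \<le> r * (A x)\<^sup>2" using dr(2)[OF True] by (intro mult_right_mono) auto
    finally show ?thesis .
  qed (simp add: \<phi>0 A0)
  have \<phi>P: "(\<integral>x. \<phi> x \<partial>lborel) \<le> r * P"
    unfolding P_def by (subst integral_mult_right_zero[symmetric]) (intro integral_mono i\<phi> integrable_mult_right iA \<phi>le)
  have pointwise: "\<bar>\<nu> x \<bullet> D x - (\<delta> - 1) * (A x)\<^sup>2\<bar> \<le> b / 2 * (A x)\<^sup>2 + 2 / b * (norm (B x))\<^sup>2" for x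
  proof (cases "x \<in> K")
    case True
    have n1: "norm (\<nu> x) = 1" using norm_normal KW True by blast
    then have "\<nu> x \<bullet> \<nu> x = 1" by (simp add: norm_eq_1)
    then have "\<nu> x \<bullet> D x - (\<delta> - 1) * (A x)\<^sup>2 = 2 * A x * (\<nu> x \<bullet> B x)"
      by (simp add: D_def B_def inner_add_right algebra_simps)
    also have "\<bar>\<dots>\<bar> = 2 * (\<bar>A x\<bar> * \<bar>\<nu> x \<bullet> B x\<bar>)" by (simp add: abs_mult)
    also have "\<dots> \<le> 2 * (\<bar>A x\<bar> * norm (B x))"
      using Cauchy_Schwarz_ineq2[of "\<nu> x" "B x"] n1 by (intro mult_left_mono) auto
    also have "\<dots> \<le> b / 2 * (A x)\<^sup>2 + 2 / b * (norm (B x))\<^sup>2"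
    proof -
      \<comment> \<open>The square behind Young's inequality with parameter
        \<open>b / 2\<close>.\<close>
      have "0 \<le> (b / 2 * \<bar>A x\<bar> - norm (B x))\<^sup>2 * (2 / b)"
        using b(2) by simp
      also have "\<dots> = b / 2 * (A x)\<^sup>2 + 2 / b * (norm (B x))\<^sup>2 - 2 * (\<bar>A x\<bar> * norm (B x))"
        using b(2) by (simp add: power2_eq_square field_simps)
      finally show ?thesis by simp
    qed
    finally show ?thesis .
  qed (simp add: A0 B0 D0)
  have "\<bar>(\<integral>x. \<nu> x \<bullet> D x \<partial>lborel) - (\<delta> - 1) * P\<bar> = \<bar>\<integral>x. \<nu> x \<bullet> D x - (\<delta> - 1) * (A x)\<^sup>2 \<partial>lborel\<bar>"
    unfolding P_def using iD iA by simp
  also have "\<dots> \<le> (\<integral>x. b / 2 * (A x)\<^sup>2 + 2 / b * (norm (B x))\<^sup>2 \<partial>lborel)"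
    by (rule order_trans[OF integral_abs_bound integral_mono])
       (use iA iB iD pointwise in \<open>auto intro!: integrable_abs Bochner_Integration.integrable_diff\<close>)
  also have "\<dots> = b / 2 * P + 2 / b * Q"
    unfolding P_def Q_def using iA iB by simp
  finally have "\<bar>\<delta> - 1\<bar> * P \<le> \<kappa> * (r * P) + (b / 2 * P + 2 / b * Q)"
  proof -
    assume *: "\<bar>(\<integral>x. \<nu> x \<bullet> D x \<partial>lborel) - (\<delta> - 1) * P\<bar> \<le> b / 2 * P + 2 / b * Q"
    have "P \<ge> 0" unfolding P_def by simp
    then have "\<bar>\<delta> - 1\<bar> * P = \<bar>(\<delta> - 1) * P\<bar>" by (simp add: abs_mult)
    moreover have "\<kappa> * (\<integral>x. \<phi> x \<partial>lborel) \<le> \<kappa> * (r * P)"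
      using \<phi>P \<kappa>_pos by simp
    ultimately show ?thesis using * weak by linarith
  qed
  moreover have "b * P = \<bar>\<delta> - 1\<bar> * P - \<kappa> * (r * P)"
    by (simp add: b(1) left_diff_distrib)
  ultimately have "b / 2 * P \<le> 2 / b * Q"
    by linarith
  then have PQ: "P \<le> (2 / b)\<^sup>2 * Q"
    using b(2) by (simp add: field_simps power2_eq_square)
  have "sqrt P \<le> 2 / b * sqrt Q"
    using real_sqrt_le_mono[OF PQ] b(2) by (simp add: real_sqrt_mult)
  moreover have "L2_norm \<Omega> (\<lambda>x. bdry_dist \<Omega> x powr (\<delta> / 2 - 1) * \<psi> x) = sqrt P"
    unfolding P_def A_def w_def
    by (subst L2_norm_compact_support[OF KO]) (auto simp: z)
  moreover have "L2_norm \<Omega> (\<lambda>x. bdry_dist \<Omega> x powr (\<delta> / 2) *\<^sub>R grad \<psi> x) = sqrt Q"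
  proof (subst L2_norm_compact_support[OF KO])
    have "d x powr (\<delta> / 2) *\<^sub>R grad \<psi> x = B x" for x
      using KO z(2)[of x] d_powr_half[of x \<delta>] by (cases "x \<in> K") (auto simp: B_def w_def)
    then show "sqrt (\<integral>x. (norm (d x powr (\<delta> / 2) *\<^sub>R grad \<psi> x))\<^sup>2 \<partial>lborel) = sqrt Q"
      by (simp add: Q_def)
  qed (auto simp: z)
  ultimately show "L2_norm \<Omega> (\<lambda>x. bdry_dist \<Omega> x powr (\<delta> / 2 - 1) * \<psi> x)
      \<le> 2 / b * L2_norm \<Omega> (\<lambda>x. bdry_dist \<Omega> x powr (\<delta> / 2) *\<^sub>R grad \<psi> x)"
    by simp
qed

end

section \<open>Non-integrability of the inverse distance\<close>

lemma nn_integral_inverse_at_0: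
  assumes "b > (0::real)"
  shows "(\<integral>\<^sup>+t. indicator {0<..<b} t * ennreal (1 / t) \<partial>lborel) = \<infinity>"
proof (rule ccontr)
  assume "\<not> ?thesis"
  then obtain C where C: "(\<integral>\<^sup>+t. indicator {0<..<b} t * ennreal (1 / t) \<partial>lborel) = ennreal C" "C \<ge> 0"
    by (metis ennreal_cases infinity_ennreal_def)
  define a where "a = b / 2"
  have a: "0 < a" "a < b" using assms by (auto simp: a_def)
  \<comment> \<open>Chosen such that the integral of \<open>1 / t\<close> from
    \<open>\<epsilon>\<close> to \<open>a\<close> is \<open>C + 1\<close>, more than the supposed
    total.\<close>
  define \<epsilon> where "\<epsilon> = a * exp (- C - 1)"
  have \<epsilon>: "0 < \<epsilon>" "\<epsilon> \<le> a" using a C(2) by (auto simp: \<epsilon>_def)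
  have "(\<integral>\<^sup>+t. ennreal (1 / t) * indicator {\<epsilon>..a} t \<partial>lborel) = ennreal (ln a - ln \<epsilon>)"
    by (rule nn_integral_FTC_Icc)
       (use \<epsilon> in \<open>auto intro!: derivative_eq_intros simp: has_real_derivative_iff_has_vector_derivative[symmetric] divide_inverse\<close>)
  moreover have "ln a - ln \<epsilon> = C + 1"
    using a by (simp add: \<epsilon>_def ln_mult)
  moreover have "(\<integral>\<^sup>+t. ennreal (1 / t) * indicator {\<epsilon>..a} t \<partial>lborel) \<le> ennreal C"
    unfolding C(1)[symmetric] by (rule nn_integral_mono) (use \<epsilon> a in \<open>auto simp: indicator_def\<close>)
  ultimately show False using C(2) by simp
qed

lemma nn_integral_inverse_at_right_end:
  assumes "b > (0::real)"
  shows "(\<integral>\<^sup>+t. indicator {0<..<b} t * ennreal (1 / (b - t)) \<partial>lborel) = \<infinity>"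
proof -
  have "(\<integral>\<^sup>+t. indicator {0<..<b} t * ennreal (1 / t) \<partial>lborel)
      = (\<integral>\<^sup>+t. indicator {0<..<b} (b + (-1) * t) * ennreal (1 / (b + (-1) * t)) \<partial>lborel)"
    using nn_integral_real_affine[of "\<lambda>t. indicator {0<..<b} t * ennreal (1 / t)" "-1" b] by simp
  also have "\<dots> = (\<integral>\<^sup>+t. indicator {0<..<b} t * ennreal (1 / (b - t)) \<partial>lborel)"
    by (rule nn_integral_cong) (auto simp: indicator_def)
  finally show ?thesis using nn_integral_inverse_at_0[OF assms] by simp
qed

lemma nn_integral_lborel_translate:
  fixes f :: "'a::euclidean_space \<Rightarrow> ennreal"
  assumes [measurable]: "f \<in> borel_measurable borel"
  shows "(\<integral>\<^sup>+x. f (x + a) \<partial>lborel) = (\<integral>\<^sup>+x. f x \<partial>lborel)"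
proof -
  have "(\<integral>\<^sup>+x. f x \<partial>lborel) = (\<integral>\<^sup>+x. f x \<partial>distr lborel borel ((+) a))"
    by (simp add: lborel_distr_plus)
  also have "\<dots> = (\<integral>\<^sup>+x. f (a + x) \<partial>lborel)"
    by (subst nn_integral_distr) auto
  finally show ?thesis by (simp add: add.commute)
qed

text \<open>The exit time is the least element of the compact set of times spent outside \<Omega>.
  The path up to it is connected and meets the frontier, necessarily at its end, because an open set
  contains no point of its frontier.\<close>

lemma segment_exit_time:
  fixes \<Omega> :: "'a::euclidean_space set"
  assumes "open \<Omega>" "x \<in> \<Omega>" "x - T *\<^sub>R e \<notin> \<Omega>" "T \<ge> 0"
  obtains b where "0 < b" "b \<le> T" "\<And>t. 0 \<le> t \<Longrightarrow> t < b \<Longrightarrow> x - t *\<^sub>R e \<in> \<Omega>" "x - b *\<^sub>R e \<in> frontier \<Omega>"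
proof -
  let ?S = "{0..T} \<inter> (\<lambda>t. x - t *\<^sub>R e) -` (- \<Omega>)"
  have "closed ?S"
    by (rule continuous_closed_preimage) (use assms(1) in \<open>auto intro!: continuous_intros\<close>)
  then have "compact ?S"
    by (metis bounded_Int bounded_closed_interval compact_eq_bounded_closed)
  moreover have "T \<in> ?S" using assms by auto
  ultimately obtain b where b: "b \<in> ?S" "\<And>t. t \<in> ?S \<Longrightarrow> b \<le> t"
    using compact_attains_inf[of ?S] by blast
  have inside: "x - t *\<^sub>R e \<in> \<Omega>" if "0 \<le> t" "t < b" for t
    using b(2)[of t] b(1) that by force
  have "b \<noteq> 0" using b(1) assms(2) by auto
  then have "b > 0" using b(1) by auto
  have "(\<lambda>t. x - t *\<^sub>R e) ` {0..b} \<inter> frontier \<Omega> \<noteq> {}"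
  proof (rule connected_Int_frontier)
    show "connected ((\<lambda>t. x - t *\<^sub>R e) ` {0..b})"
      by (intro connected_continuous_image continuous_intros) auto
    show "(\<lambda>t. x - t *\<^sub>R e) ` {0..b} \<inter> \<Omega> \<noteq> {}"
      using assms(2) \<open>b > 0\<close> by (auto intro!: exI[of _ x] image_eqI[of _ _ 0])
    have "x - b *\<^sub>R e \<in> (\<lambda>t. x - t *\<^sub>R e) ` {0..b} - \<Omega>"
      using b(1) \<open>b > 0\<close> by (intro DiffI imageI) auto
    then show "(\<lambda>t. x - t *\<^sub>R e) ` {0..b} - \<Omega> \<noteq> {}"
      by blast
  qed
  then obtain t where t: "0 \<le> t" "t \<le> b" "x - t *\<^sub>R e \<in> frontier \<Omega>" by auto
  then have "x - t *\<^sub>R e \<notin> \<Omega>" using assms(1) by (simp add: frontier_def interior_open)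
  with inside t have "t = b" by force
  with t b(1) \<open>b > 0\<close> inside show thesis by (intro that[of b]) auto
qed

text \<open>Integration along lines in the normal direction at \<open>p\<close>, without flattening
  the boundary. Every such line from a small ball inside \<Omega> reaches the outer tangent ball,
  hence crosses \<Gamma> at some time \<open>b\<close>; at time \<open>t\<close> the distance is at
  most \<open>b - t\<close>, so the integral of its inverse along the line diverges.\<close>

lemma nn_integral_inverse_bdry_dist:
  fixes \<Omega> :: "(real^'d) set"
  assumes \<Omega>: "C11_domain \<Omega>" and p: "p \<in> frontier \<Omega>" and \<rho>: "\<rho> > 0"
  shows "(\<integral>\<^sup>+x. indicator (\<Omega> \<inter> ball p \<rho>) x * ennreal (1 / bdry_dist \<Omega> x) \<partial>lborel) = \<infinity>"
proof -
  have op: "open \<Omega>" using \<Omega> by (simp add: C11_domain_def)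
  obtain u y y' where u: "u > 0" and y: "y \<in> \<Omega>" "cball y u \<inter> - \<Omega> = {p}"
      and y': "y' \<in> - \<Omega>" "cball y' u \<inter> closure \<Omega> = {p}"
    using \<Omega> p unfolding C11_domain_def by blast
  note tangent = frontier_ball_tangent[OF op p u y y']
  define e where "e = (1 / u) *\<^sub>R (y - p)"
  have ne: "norm e = 1" using u tangent(1) by (simp add: e_def dist_norm norm_minus_commute)
  have ye: "y = p + u *\<^sub>R e" using u by (simp add: e_def)
  have ye': "y' = p - u *\<^sub>R e" using u tangent(5) by (simp add: e_def algebra_simps)
  \<comment> \<open>\<open>\<sigma> \<le> u\<close> puts \<open>B\<close> into the inner ball and
    its translate by \<open>- (2 * \<sigma>) *\<^sub>R e\<close> into the outer one;
    \<open>2 * \<sigma> \<le> \<rho>\<close> keeps the relevant part of the lines in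
    \<open>ball p \<rho>\<close>.\<close>
  define \<sigma> where "\<sigma> = min (\<rho> / 2) u"
  have \<sigma>: "0 < \<sigma>" "\<sigma> \<le> u" "2 * \<sigma> \<le> \<rho>" using u \<rho> by (auto simp: \<sigma>_def)
  define B where "B = ball (p + \<sigma> *\<^sub>R e) \<sigma>"
  define f where "f x = indicator (\<Omega> \<inter> ball p \<rho>) x * ennreal (1 / bdry_dist \<Omega> x)" for x
  have [measurable]: "\<Omega> \<in> sets borel" "B \<in> sets borel" using op by (auto simp: B_def)
  have [measurable]: "bdry_dist \<Omega> \<in> borel_measurable borel"
    unfolding bdry_dist_def by (intro borel_measurable_continuous_onI continuous_intros)
  have fm[measurable]: "f \<in> borel_measurable borel"
    unfolding f_def
    by (intro borel_measurable_times_ennreal borel_measurable_indicator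
        measurable_compose[OF borel_measurable_divide measurable_ennreal]) auto
  have inner: "(\<integral>\<^sup>+t. indicator {0..2*\<sigma>} t * f (x - t *\<^sub>R e) \<partial>lborel) = \<infinity>" if x: "x \<in> B" for x
  proof -
    have dB: "norm (x - (p + \<sigma> *\<^sub>R e)) < \<sigma>"
      using x by (simp add: B_def dist_norm norm_minus_commute)
    have "dist x y \<le> norm (x - (p + \<sigma> *\<^sub>R e)) + norm ((u - \<sigma>) *\<^sub>R e)"
      unfolding ye dist_norm
      by (rule order_trans[OF _ norm_triangle_ineq4]) (simp add: algebra_simps)
    then have "x \<in> ball y u" using dB \<sigma> ne by (simp add: dist_commute)
    then have x1: "x \<in> \<Omega>" using tangent(3) by blast
    have "x - (2*\<sigma>) *\<^sub>R e - y' = (x - (p + \<sigma> *\<^sub>R e)) + (u - \<sigma>) *\<^sub>R e"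
      unfolding ye' mult_2 scaleR_add_left scaleR_diff_left by simp
    then have "dist (x - (2*\<sigma>) *\<^sub>R e) y' \<le> norm (x - (p + \<sigma> *\<^sub>R e)) + norm ((u - \<sigma>) *\<^sub>R e)"
      unfolding dist_norm using norm_triangle_ineq by metis
    then have "x - (2*\<sigma>) *\<^sub>R e \<in> ball y' u" using dB \<sigma> ne by (simp add: dist_commute)
    then have x2: "x - (2*\<sigma>) *\<^sub>R e \<notin> \<Omega>" using tangent(4) closure_subset[of \<Omega>] by blast
    obtain b where b: "0 < b" "b \<le> 2*\<sigma>" "\<And>t. 0 \<le> t \<Longrightarrow> t < b \<Longrightarrow> x - t *\<^sub>R e \<in> \<Omega>"
        "x - b *\<^sub>R e \<in> frontier \<Omega>"
      using segment_exit_time[OF op x1 x2] \<sigma> by auto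
    have "indicator {0<..<b} t * ennreal (1 / (b - t)) \<le> indicator {0..2*\<sigma>} t * f (x - t *\<^sub>R e)" for t
    proof (cases "0 < t \<and> t < b")
      case True
      then have t: "0 < t" "t < b" by auto
      have tO: "x - t *\<^sub>R e \<in> \<Omega>" using b(3)[of t] t by simp
      have "dist (x - t *\<^sub>R e) p \<le> norm (x - (p + \<sigma> *\<^sub>R e)) + norm ((\<sigma> - t) *\<^sub>R e)"
        unfolding dist_norm by (rule order_trans[OF _ norm_triangle_ineq]) (simp add: algebra_simps)
      also have "\<dots> < \<sigma> + \<sigma>" using dB t b(2) ne by (simp add: abs_if)
      finally have tB: "x - t *\<^sub>R e \<in> ball p \<rho>" using \<sigma> by (simp add: dist_commute)
      have "bdry_dist \<Omega> (x - t *\<^sub>R e) \<le> dist (x - t *\<^sub>R e) (x - b *\<^sub>R e)"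
        unfolding bdry_dist_def by (rule infdist_le[OF b(4)])
      also have "\<dots> = norm ((b - t) *\<^sub>R e)" by (simp add: dist_norm algebra_simps)
      finally have le: "bdry_dist \<Omega> (x - t *\<^sub>R e) \<le> b - t" using t ne by simp
      have "x - t *\<^sub>R e \<notin> frontier \<Omega>" using tO op by (simp add: frontier_def interior_open)
      then have "0 < bdry_dist \<Omega> (x - t *\<^sub>R e)"
        unfolding bdry_dist_def using infdist_pos_not_in_closed[OF frontier_closed] p by auto
      then have "1 / (b - t) \<le> 1 / bdry_dist \<Omega> (x - t *\<^sub>R e)"
        using le by (intro divide_left_mono) auto
      then show ?thesis
        using t b(2) tO tB by (simp add: f_def ennreal_leI)
    qed (auto simp: indicator_def)
    then have "(\<integral>\<^sup>+t. indicator {0<..<b} t * ennreal (1 / (b - t)) \<partial>lborel)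
        \<le> (\<integral>\<^sup>+t. indicator {0..2*\<sigma>} t * f (x - t *\<^sub>R e) \<partial>lborel)"
      by (intro nn_integral_mono)
    then show ?thesis
      using nn_integral_inverse_at_right_end[OF b(1)] by (simp add: top.extremum_unique)
  qed
  have Bpos: "emeasure lborel B > 0"
  proof -
    have "emeasure lborel B = ennreal (measure lborel B)"
      unfolding B_def by (intro emeasure_eq_ennreal_measure) (metis emeasure_lborel_ball_finite infinity_ennreal_def less_irrefl)
    moreover have "measure lborel B > 0"
      unfolding B_def using content_ball_pos[OF \<sigma>(1)] by simp
    ultimately show ?thesis by simp
  qed
  \<comment> \<open>The line integrals are infinite for all starting points in a set of positive
    measure. Exchanging the integrals and using translation invariance bounds the result by
    \<open>2 * \<sigma>\<close> times the integral of \<open>f\<close>.\<close>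
  have "\<infinity> = (\<integral>\<^sup>+x. \<infinity> * indicator B x \<partial>lborel)"
    by (subst nn_integral_cmult_indicator) (use Bpos in \<open>auto simp: ennreal_top_mult\<close>)
  also have "\<dots> = (\<integral>\<^sup>+x. indicator B x * (\<integral>\<^sup>+t. indicator {0..2*\<sigma>} t * f (x - t *\<^sub>R e) \<partial>lborel) \<partial>lborel)"
    by (rule nn_integral_cong) (use inner in \<open>auto simp: indicator_def\<close>)
  also have "\<dots> = (\<integral>\<^sup>+x. (\<integral>\<^sup>+t. indicator B x * (indicator {0..2*\<sigma>} t * f (x - t *\<^sub>R e)) \<partial>lborel) \<partial>lborel)"
    by (rule nn_integral_cong) (subst nn_integral_cmult; simp)
  also have "\<dots> = (\<integral>\<^sup>+t. (\<integral>\<^sup>+x. indicator B x * (indicator {0..2*\<sigma>} t * f (x - t *\<^sub>R e)) \<partial>lborel) \<partial>lborel)"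
    by (rule lborel_pair.Fubini') measurable
  also have "\<dots> \<le> (\<integral>\<^sup>+t. indicator {0..2*\<sigma>} t * (\<integral>\<^sup>+x. f x \<partial>lborel) \<partial>lborel)"
  proof (rule nn_integral_mono)
    fix t :: real
    have "(\<integral>\<^sup>+x. indicator B x * (indicator {0..2*\<sigma>} t * f (x - t *\<^sub>R e)) \<partial>lborel)
        \<le> (\<integral>\<^sup>+x. indicator {0..2*\<sigma>} t * f (x + (- t) *\<^sub>R e) \<partial>lborel)"
      by (rule nn_integral_mono) (auto simp: indicator_def)
    also have "\<dots> = indicator {0..2*\<sigma>} t * (\<integral>\<^sup>+x. f (x + (- t) *\<^sub>R e) \<partial>lborel)"
      by (rule nn_integral_cmult) simp
    finally show "(\<integral>\<^sup>+x. indicator B x * (indicator {0..2*\<sigma>} t * f (x - t *\<^sub>R e)) \<partial>lborel)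
        \<le> indicator {0..2*\<sigma>} t * (\<integral>\<^sup>+x. f x \<partial>lborel)"
      unfolding nn_integral_lborel_translate[OF fm] .
  qed
  also have "\<dots> = (\<integral>\<^sup>+t. (\<integral>\<^sup>+x. f x \<partial>lborel) * indicator {0..2*\<sigma>} t \<partial>lborel)"
    by (simp only: mult.commute)
  also have "\<dots> = (\<integral>\<^sup>+x. f x \<partial>lborel) * ennreal (2 * \<sigma>)"
    using \<sigma> by (subst nn_integral_cmult_indicator) auto
  finally have "(\<integral>\<^sup>+x. f x \<partial>lborel) * ennreal (2 * \<sigma>) = \<infinity>"
    by (simp add: top.extremum_unique)
  then show ?thesis
    unfolding f_def[symmetric] by (auto simp: ennreal_mult_eq_top_iff)
qed

section \<open>Cutoff functions\<close>

text \<open>The open sets \<open>U\<close> and \<open>- K\<close> cover the space, and the gradient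
  is continuous on each. Regularity is asked on \<open>U\<close> only, which need not be contained
  in \<open>V\<close>.\<close>

lemma C1cI:
  assumes U: "open U" and K: "compact K" "K \<subseteq> U" "K \<subseteq> V"
    and z: "\<And>x. x \<notin> K \<Longrightarrow> \<psi> x = 0"
    and D: "\<And>x. x \<in> U \<Longrightarrow> GDERIV \<psi> x :> D x" "continuous_on U D"
  shows "\<psi> \<in> C1c V"
proof -
  note cK = compact_imp_closed[OF K(1)]
  have gz: "GDERIV \<psi> x :> 0" if "x \<notin> K" for x
    by (rule gderiv_zero_outside[OF cK z that])
  have "continuous_on U (grad \<psi>)"
    using D(2) by (rule continuous_on_eq) (use grad_eq[OF D(1)] in auto)
  moreover have "continuous_on (- K) (grad \<psi>)"
    by (rule continuous_on_eq[OF continuous_on_const[of _ 0]]) (use grad_eq[OF gz] in auto)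
  ultimately have "continuous_on (U \<union> - K) (grad \<psi>)"
    using U cK by (intro continuous_on_open_Un) auto
  moreover have "U \<union> - K = UNIV" using K(2) by blast
  ultimately have "continuous_on V (grad \<psi>)"
    using continuous_on_subset[of UNIV "grad \<psi>" V] by simp
  moreover have "closure {x. \<psi> x \<noteq> 0} \<subseteq> K"
    using z by (intro closure_minimal cK) auto
  moreover from this have "compact (closure {x. \<psi> x \<noteq> 0})"
    using K(1) by (metis closed_closure compact_Int_closed inf.absorb_iff2)
  moreover have "\<exists>D. GDERIV \<psi> x :> D" for x
    using D(1)[of x] gz[of x] K(2) by blast
  ultimately show ?thesis using K(3) by (auto simp: C1c_def)
qed

text \<open>At 0 the difference quotient is bounded by \<open>\<bar>y\<bar>\<close>. Squaring thus
  makes the positive part continuously differentiable, which is why \<open>bump\<close> and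
  \<open>cutoff\<close> are built from such squares.\<close>

lemma DERIV_pos_part_square: "DERIV (\<lambda>y. (max 0 y)\<^sup>2) y :> 2 * max 0 (y :: real)"
proof (cases y "0 :: real" rule: linorder_cases)
  case greater
  have "DERIV (\<lambda>y. y\<^sup>2) y :> 2 * max 0 y"
    using greater by (auto intro!: derivative_eq_intros)
  then show ?thesis
    by (rule has_field_derivative_transform_within_open[where S = "{0<..}"]) (use greater in auto)
next
  case less
  have "DERIV (\<lambda>y. 0) y :> 2 * max 0 y"
    using less by (auto intro!: derivative_eq_intros)
  then show ?thesis
    by (rule has_field_derivative_transform_within_open[where S = "{..<0}"]) (use less in auto)
next
  case equal
  have "((\<lambda>y :: real. (max 0 y)\<^sup>2) has_derivative (\<lambda>h. 0)) (at 0)"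
  proof (rule has_derivativeI_sandwich[where e = 1 and H = "\<lambda>y. \<bar>y\<bar>"])
    show "((\<lambda>y::real. \<bar>y\<bar>) \<longlongrightarrow> 0) (at 0)" by (auto intro!: tendsto_eq_intros)
    fix y :: real assume "y \<noteq> 0"
    then show "norm ((max 0 y)\<^sup>2 - (max 0 0)\<^sup>2 - 0) / norm (y - 0) \<le> \<bar>y\<bar>"
      by (auto simp: max_def power2_eq_square)
  qed auto
  then show ?thesis
    using equal by (simp add: has_field_derivative_def mult_zero_left[abs_def])
qed

definition bump :: "real^'d \<Rightarrow> real \<Rightarrow> real^'d \<Rightarrow> real" where
  "bump p R x = (max 0 (1 - (norm (x - p))\<^sup>2 / R\<^sup>2))\<^sup>2"

definition bump_grad :: "real^'d \<Rightarrow> real \<Rightarrow> real^'d \<Rightarrow> real^'d" where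
  "bump_grad p R x = (- 4 * max 0 (1 - (norm (x - p))\<^sup>2 / R\<^sup>2) / R\<^sup>2) *\<^sub>R (x - p)"

text \<open>Zero for \<open>0 < t \<le> s\<close> and tending to 1 as \<open>s\<close> tends to 0.
  Depending on \<open>s / t\<close> only makes \<open>t * cutoff_deriv s t\<close> bounded uniformly
  in \<open>s\<close>.\<close>

definition cutoff :: "real \<Rightarrow> real \<Rightarrow> real" where
  "cutoff s t = (max 0 (1 - s / t))\<^sup>2"

definition cutoff_deriv :: "real \<Rightarrow> real \<Rightarrow> real" where
  "cutoff_deriv s t = 2 * max 0 (1 - s / t) * (s / t\<^sup>2)"

lemma gderiv_bump: "GDERIV (bump p R) x :> bump_grad p R x"
proof -
  have "GDERIV (\<lambda>x. 1 - (norm (x - p))\<^sup>2 / R\<^sup>2) x :> (- 2 / R\<^sup>2) *\<^sub>R (x - p)"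
    unfolding gderiv_def power2_norm_eq_inner divide_inverse
    by (auto intro!: derivative_eq_intros simp: fun_eq_iff inner_commute)
  from GDERIV_DERIV_compose[OF this DERIV_pos_part_square] show ?thesis
    by (simp add: bump_def[abs_def] bump_grad_def)
qed

lemma bump_bounds: "0 \<le> bump p R x" "bump p R x \<le> 1"
proof -
  have "(max 0 (1 - (norm (x - p))\<^sup>2 / R\<^sup>2))\<^sup>2 \<le> 1\<^sup>2"
    by (intro power_mono) auto
  then show "0 \<le> bump p R x" "bump p R x \<le> 1" by (simp_all add: bump_def)
qed

lemma norm_quotient_gt_1:
  assumes "x \<notin> cball p R" "R > 0"
  shows "1 < (norm (x - p))\<^sup>2 / R\<^sup>2"
proof -
  have "R\<^sup>2 < (norm (x - p))\<^sup>2"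
    using assms by (intro power_strict_mono) (auto simp: dist_norm norm_minus_commute)
  then show ?thesis using assms(2) by simp
qed

lemma bump_outside: "x \<notin> cball p R \<Longrightarrow> R > 0 \<Longrightarrow> bump p R x = 0"
    and bump_grad_outside: "x \<notin> cball p R \<Longrightarrow> R > 0 \<Longrightarrow> bump_grad p R x = 0"
  using norm_quotient_gt_1[of x p R] by (simp_all add: bump_def bump_grad_def)

lemma bump_inner_ball:
  assumes "x \<in> ball p (R / 2)" "R > 0"
  shows "1 / 4 \<le> (bump p R x)\<^sup>2"
proof -
  have "(norm (x - p))\<^sup>2 \<le> (R / 2)\<^sup>2"
    using assms by (intro power_mono) (auto simp: dist_norm norm_minus_commute)
  then have "(norm (x - p))\<^sup>2 / R\<^sup>2 \<le> 1 / 4"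
    using assms(2) by (simp add: power_divide field_simps)
  then have "3 / 4 \<le> max 0 (1 - (norm (x - p))\<^sup>2 / R\<^sup>2)"
    by (intro max.coboundedI2) linarith
  then have "(3 / 4)\<^sup>2 \<le> bump p R x"
    unfolding bump_def by (rule power_mono) simp
  then have "((3 / 4)\<^sup>2)\<^sup>2 \<le> (bump p R x)\<^sup>2"
    by (rule power_mono) simp
  then show ?thesis by (simp add: power2_eq_square)
qed

lemma norm_bump_grad:
  assumes "R > 0"
  shows "norm (bump_grad p R x) \<le> 4 / R"
proof (cases "x \<in> cball p R")
  case True
  have "norm (bump_grad p R x) = 4 / R\<^sup>2 * max 0 (1 - (norm (x - p))\<^sup>2 / R\<^sup>2) * norm (x - p)"
    by (simp add: bump_grad_def abs_mult)
  also have "\<dots> \<le> 4 / R\<^sup>2 * 1 * R"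
    using True assms by (intro mult_mono) (auto simp: dist_norm norm_minus_commute)
  finally show ?thesis using assms by (simp add: power2_eq_square)
qed (use assms in \<open>simp add: bump_grad_outside\<close>)

lemma continuous_on_bump [continuous_intros]: "continuous_on S (bump p R)"
  and continuous_on_bump_grad [continuous_intros]: "continuous_on S (bump_grad p R)"
  unfolding bump_def bump_grad_def by (cases "R = 0"; auto intro!: continuous_intros)+

lemma DERIV_cutoff:
  assumes "t > 0"
  shows "DERIV (cutoff s) t :> cutoff_deriv s t"
proof -
  have "DERIV (\<lambda>t. 1 - s / t) t :> s / t\<^sup>2"
    using assms by (auto intro!: derivative_eq_intros simp: power2_eq_square)
  from DERIV_chain2[OF DERIV_pos_part_square this] show ?thesis
    by (simp add: cutoff_def[abs_def] cutoff_deriv_def)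
qed

lemma cutoff_bounds:
  assumes "s > 0" "t > 0"
  shows "0 \<le> cutoff s t" "cutoff s t \<le> 1" "0 \<le> cutoff_deriv s t" "t * cutoff_deriv s t \<le> 2"
proof -
  have "(max 0 (1 - s / t))\<^sup>2 \<le> 1\<^sup>2"
    using assms by (intro power_mono) auto
  then show "0 \<le> cutoff s t" "cutoff s t \<le> 1" by (simp_all add: cutoff_def)
  show "0 \<le> cutoff_deriv s t" using assms by (simp add: cutoff_deriv_def)
  show "t * cutoff_deriv s t \<le> 2"
  proof (cases "s \<le> t")
    case True
    have "t * cutoff_deriv s t = 2 * ((1 - s / t) * (s / t))"
      using True assms by (simp add: cutoff_deriv_def power2_eq_square)
    also have "\<dots> \<le> 2 * (1 * 1)"
      using True assms by (intro mult_left_mono mult_mono) auto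
    finally show ?thesis by simp
  next
    case False
    then have "1 - s / t \<le> 0" using assms by (simp add: field_simps)
    then show ?thesis by (simp add: cutoff_deriv_def)
  qed
qed

lemma cutoff_outside:
  assumes "0 < t" "t < s"
  shows "cutoff s t = 0" "cutoff_deriv s t = 0"
proof -
  have "1 - s / t \<le> 0" using assms by (simp add: field_simps)
  then show "cutoff s t = 0" "cutoff_deriv s t = 0" by (simp_all add: cutoff_def cutoff_deriv_def)
qed

section \<open>Test functions near a boundary point and the lower bound for the Hardy
  constant\<close>

locale boundary_bump = regular_layer +
  fixes p :: "real^'a" and R :: real
  assumes p: "p \<in> frontier \<Omega>" and R: "0 < R" "R < \<rho>"
begin

text \<open>Taking \<open>closure \<Omega>\<close> makes the set compact; for \<open>s > 0\<close>
  the last condition excludes the frontier, so the set still lies in \<Omega>.\<close>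

definition "supp s = cball p R \<inter> closure \<Omega> \<inter> {x. s \<le> d x}"
text \<open>The distance to \<Gamma> is positive beyond \<Gamma> as well, so the cutoff alone would
  not vanish there.\<close>

definition "G s x = (if x \<in> \<Omega> then cutoff s (d x) else 0)"
definition "G' s x = (if x \<in> \<Omega> then cutoff_deriv s (d x) else 0)"
abbreviation "\<eta> \<equiv> bump p R"
abbreviation "D\<eta> \<equiv> bump_grad p R"
text \<open>The squared left-hand norm for the test function; it is the same for all
  \<open>\<delta>\<close>, because the powers of the distance combine to
  \<open>1 / d x\<close>.\<close>

definition "energy s = (\<integral>x. (G s x * \<eta> x)\<^sup>2 / d x \<partial>lborel)"

lemma d_le: "x \<in> cball p R \<Longrightarrow> d x \<le> R"
  using infdist_le[OF p, of x] by (simp add: bdry_dist_def dist_commute)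

context
  fixes s :: real
  assumes s: "s > 0"
begin

lemma supp_subset: "supp s \<subseteq> \<Omega>" "supp s \<subseteq> W" "R < r \<Longrightarrow> supp s \<subseteq> bdry_layer \<Omega> r"
proof -
  have "x \<in> \<Omega>" if "x \<in> supp s" for x
  proof -
    have "x \<notin> frontier \<Omega>"
    proof
      assume "x \<in> frontier \<Omega>"
      then have "d x = 0" by (simp add: bdry_dist_def)
      then show False using that s by (simp add: supp_def)
    qed
    then show ?thesis
      using that open_domain by (auto simp: supp_def frontier_def interior_open)
  qed
  moreover have "d x \<le> R" if "x \<in> supp s" for x
    using that d_le by (auto simp: supp_def)
  ultimately show "supp s \<subseteq> \<Omega>" "supp s \<subseteq> W" "R < r \<Longrightarrow> supp s \<subseteq> bdry_layer \<Omega> r"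
    using R by (force simp: bdry_layer_def)+
qed

lemma compact_supp: "compact (supp s)"
proof -
  have "closed (closure \<Omega> \<inter> {x. s \<le> d x})"
    by (intro closed_Int closed_closure closed_Collect_le continuous_on_const continuous_on_bdry_dist)
  then show ?thesis unfolding supp_def Int_assoc by (intro compact_Int_closed) auto
qed

lemma outside_supp:
  assumes "x \<notin> supp s"
  shows "G s x * \<eta> x = 0" "G' s x * \<eta> x = 0" "G s x *\<^sub>R D\<eta> x = 0"
proof -
  have "x \<notin> \<Omega> \<or> x \<notin> cball p R \<or> (x \<in> \<Omega> \<and> d x < s)"
    using assms closure_subset[of \<Omega>] by (auto simp: supp_def)
  then show "G s x * \<eta> x = 0" "G' s x * \<eta> x = 0" "G s x *\<^sub>R D\<eta> x = 0"
    using R(1) by (auto simp: G_def G'_def bump_outside bump_grad_outside cutoff_outside d_pos)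
qed

lemma G_bounds: "0 \<le> G s x" "G s x \<le> 1" "0 \<le> G' s x" "x \<in> \<Omega> \<Longrightarrow> d x * G' s x \<le> 2"
  using cutoff_bounds[OF s d_pos] by (auto simp: G_def G'_def)

lemma continuous_on_G:
  assumes "S \<subseteq> \<Omega>"
  shows "continuous_on S (G s)" "continuous_on S (G' s)"
proof -
  have "continuous_on S (\<lambda>x. cutoff s (d x))" "continuous_on S (\<lambda>x. cutoff_deriv s (d x))"
    unfolding cutoff_def cutoff_deriv_def using assms d_pos
    by (intro continuous_intros continuous_on_bdry_dist ballI; force)+
  note cont = this
  show "continuous_on S (G s)"
    using cont(1) by (rule continuous_on_eq) (use assms in \<open>auto simp: G_def\<close>)
  show "continuous_on S (G' s)"
    using cont(2) by (rule continuous_on_eq) (use assms in \<open>auto simp: G'_def\<close>)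
qed

lemma gderiv_G:
  assumes "x \<in> W"
  shows "GDERIV (G s) x :> G' s x *\<^sub>R \<nu> x"
proof -
  have x: "x \<in> \<Omega>" by (rule W_subset[OF assms])
  have "GDERIV (\<lambda>x. cutoff s (d x)) x :> cutoff_deriv s (d x) *\<^sub>R \<nu> x"
    by (rule GDERIV_DERIV_compose[OF gderiv_d[OF assms] DERIV_cutoff[OF d_pos[OF x]]])
  then have "GDERIV (\<lambda>x. cutoff s (d x)) x :> G' s x *\<^sub>R \<nu> x"
    using x by (simp add: G'_def)
  then show ?thesis
    unfolding gderiv_def
    by (rule has_derivative_transform_within_open[OF _ open_domain x]) (simp add: G_def)
qed

lemma integrable_energy: "integrable lborel (\<lambda>x. (G s x * \<eta> x)\<^sup>2 / d x)"
proof (rule integrable_compact_support[OF compact_supp])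
  show "continuous_on (supp s) (\<lambda>x. (G s x * \<eta> x)\<^sup>2 / d x)"
    using supp_subset(1) d_pos
    by (intro continuous_intros continuous_on_G continuous_on_bdry_dist ballI; force)
qed (simp add: outside_supp)

lemma integrable_cutoff_deriv: "integrable lborel (\<lambda>x. G' s x * \<eta> x)"
  by (rule integrable_compact_support[OF compact_supp])
     (auto intro!: continuous_intros continuous_on_G supp_subset simp: outside_supp)

text \<open>The point is uniformity in \<open>s\<close>. For \<open>\<phi> = G s * \<eta>\<close>
  the product \<open>\<nu> x \<bullet> D x\<close> is \<open>G' s x * \<eta> x\<close> plus a term
  of size at most \<open>4 / R\<close> on the ball, and the weak bound controls its integral by the
  measure of the ball.\<close>

lemma integral_cutoff_deriv_le:
  "(\<integral>x. G' s x * \<eta> x \<partial>lborel) \<le> (\<kappa> + 4 / R) * measure lborel (cball p R)"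
proof -
  define \<phi> where "\<phi> x = G s x * \<eta> x" for x
  define D where "D x = (G' s x * \<eta> x) *\<^sub>R \<nu> x + G s x *\<^sub>R D\<eta> x" for x
  have out: "\<phi> x = 0" "D x = 0" if "x \<notin> supp s" for x
    unfolding \<phi>_def D_def outside_supp[OF that] by simp_all
  have ball: "x \<in> cball p R" if "x \<in> supp s" for x
    using that by (simp add: supp_def)
  have d\<phi>: "GDERIV \<phi> x :> D x" for x
  proof (cases "x \<in> supp s")
    case True
    then have "x \<in> W" using supp_subset(2) by blast
    from GDERIV_mult[OF gderiv_G[OF this] gderiv_bump] show ?thesis
      unfolding \<phi>_def D_def by (simp add: add.commute mult.commute)
  next
    case False
    then show ?thesis
      using gderiv_zero_outside[OF compact_imp_closed[OF compact_supp] out(1)] out(2) by simp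
  qed
  have cD: "continuous_on (supp s) D" unfolding D_def
    by (intro continuous_intros continuous_on_G supp_subset continuous_on_subset[OF continuous_on_normal])
  have cI: "continuous_on (supp s) (\<lambda>x. \<nu> x \<bullet> D x)"
    by (intro continuous_intros cD continuous_on_subset[OF continuous_on_normal supp_subset(2)])
  have \<phi>b: "0 \<le> \<phi> x" "\<phi> x \<le> indicator (cball p R) x" for x
  proof -
    show "0 \<le> \<phi> x" by (simp add: \<phi>_def G_bounds bump_bounds)
    have "\<phi> x \<le> 1" unfolding \<phi>_def using G_bounds bump_bounds by (intro mult_le_one) auto
    then show "\<phi> x \<le> indicator (cball p R) x"
      using out(1)[of x] ball[of x] by (cases "x \<in> supp s") auto
  qed
  have iB: "integrable lborel (indicator (cball p R) :: _ \<Rightarrow> real)"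
    by (intro integrable_real_indicator emeasure_lborel_cball_finite) simp
  have i\<phi>: "integrable lborel \<phi>"
    by (rule integrable_compact_support[OF compact_supp])
       (auto simp: \<phi>_def outside_supp intro!: continuous_intros continuous_on_G supp_subset)
  have iD: "integrable lborel (\<lambda>x. \<nu> x \<bullet> D x)"
    by (rule integrable_compact_support[OF compact_supp cI]) (simp add: out)
  have "(\<integral>x. \<phi> x \<partial>lborel) \<le> (\<integral>x. indicator (cball p R) x \<partial>lborel)"
    by (intro integral_mono i\<phi> iB \<phi>b)
  then have \<phi>m: "\<kappa> * (\<integral>x. \<phi> x \<partial>lborel) \<le> \<kappa> * measure lborel (cball p R)"
    using \<kappa>_pos by simp
  have weak: "\<bar>\<integral>x. \<nu> x \<bullet> D x \<partial>lborel\<bar> \<le> \<kappa> * (\<integral>x. \<phi> x \<partial>lborel)"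
    by (rule weak_laplacian_bound[OF compact_supp supp_subset(2) \<phi>b(1) out(1) d\<phi> cD out(2)])
  have pointwise: "G' s x * \<eta> x \<le> \<nu> x \<bullet> D x + 4 / R * indicator (cball p R) x" for x
  proof (cases "x \<in> supp s")
    case True
    then have n: "norm (\<nu> x) = 1" using supp_subset(2) norm_normal by blast
    then have "\<nu> x \<bullet> \<nu> x = 1" by (simp add: norm_eq_1)
    then have eq: "\<nu> x \<bullet> D x = G' s x * \<eta> x + G s x * (\<nu> x \<bullet> D\<eta> x)"
      by (simp add: D_def inner_add_right)
    have "\<bar>\<nu> x \<bullet> D\<eta> x\<bar> \<le> 4 / R"
      using Cauchy_Schwarz_ineq2[of "\<nu> x" "D\<eta> x"] n norm_bump_grad[OF R(1), of p x] by simp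
    then have "\<bar>G s x * (\<nu> x \<bullet> D\<eta> x)\<bar> \<le> 1 * (4 / R)"
      unfolding abs_mult using G_bounds(1,2)[of x] by (intro mult_mono) auto
    then show ?thesis using eq ball[OF True] by simp
  next
    case False
    show ?thesis
      unfolding outside_supp(2)[OF False] out(2)[OF False] using R(1) by simp
  qed
  have "(\<integral>x. G' s x * \<eta> x \<partial>lborel) \<le> (\<integral>x. \<nu> x \<bullet> D x + 4 / R * indicator (cball p R) x \<partial>lborel)"
    using iD iB by (intro integral_mono integrable_cutoff_deriv pointwise) auto
  also have "\<dots> = (\<integral>x. \<nu> x \<bullet> D x \<partial>lborel) + 4 / R * measure lborel (cball p R)"
    using iD iB by simp
  finally show ?thesis using weak \<phi>m by (simp add: distrib_right)
qed

text \<open>The test function \<open>\<psi>\<close> turns the Hardy inequality into an inequality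
  for \<open>energy s\<close>: the gradient of the power of the distance reproduces the energy with
  factor \<open>((\<delta> - 1) / 2)\<^sup>2\<close>, and everything else is bounded independently
  of \<open>s\<close>.\<close>

lemma hardy_imp_energy_le:
  assumes hardy: "boundary_hardy \<Omega> \<delta> r a" and r: "R < r" and \<theta>: "\<theta> > 0"
  shows "energy s \<le> a\<^sup>2 * ((1 + \<theta>) * ((\<delta> - 1) / 2)\<^sup>2 * energy s
           + (1 + 1 / \<theta>) * (4 * ((\<kappa> + 4 / R) * measure lborel (cball p R)) + 32 / R * measure lborel (cball p R)))"
proof -
  \<comment> \<open>The critical exponent: the left-hand weight times \<open>v\<close> is
    \<open>d powr (- 1 / 2)\<close>, whose square just fails to be integrable near \<Gamma>.\<close>
  define \<beta> where "\<beta> = (1 - \<delta>) / 2"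
  define v where "v x = d x powr \<beta>" for x
  define \<psi> where "\<psi> x = v x * (G s x * \<eta> x)" for x
  define D where "D x = (v x * (\<beta> * (G s x * \<eta> x) / d x + G' s x * \<eta> x)) *\<^sub>R \<nu> x + v x *\<^sub>R (G s x *\<^sub>R D\<eta> x)" for x
  have out: "\<psi> x = 0" "D x = 0" if "x \<notin> supp s" for x
    unfolding \<psi>_def D_def outside_supp[OF that] by simp_all
  have WO: "W \<subseteq> \<Omega>" using W_subset by blast
  have dne: "\<forall>x\<in>W. d x \<noteq> 0" using d_pos W_subset by force
  have cD: "continuous_on W D"
    unfolding D_def v_def
    by (intro continuous_intros continuous_on_G continuous_on_bdry_dist continuous_on_normal continuous_on_d_powr dne WO)
  have d\<psi>: "GDERIV \<psi> x :> D x" if x: "x \<in> W" for x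
  proof -
    have "GDERIV v x :> (\<beta> * (v x / d x)) *\<^sub>R \<nu> x"
      unfolding v_def by (rule gderiv_d_powr[OF x])
    from GDERIV_mult[OF this GDERIV_mult[OF gderiv_G[OF x] gderiv_bump]]
    show ?thesis unfolding \<psi>_def
    proof (rule GDERIV_subst)
      have eq: "v x * (\<beta> * (G s x * \<eta> x) / d x + G' s x * \<eta> x) = v x * (\<eta> x * G' s x) + G s x * \<eta> x * (\<beta> * (v x / d x))"
        by (simp add: algebra_simps)
      show "v x *\<^sub>R (G s x *\<^sub>R D\<eta> x + \<eta> x *\<^sub>R G' s x *\<^sub>R \<nu> x) + (G s x * \<eta> x) *\<^sub>R (\<beta> * (v x / d x)) *\<^sub>R \<nu> x = D x"
        unfolding D_def eq scaleR_add_left scaleR_add_right scaleR_scaleR by simp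
    qed
  qed
  \<comment> \<open>Differentiability is known on \<open>W\<close>, the support condition follows
    from \<open>R < r\<close>; \<open>r\<close> may exceed \<open>\<rho>\<close>.\<close>
  have mem: "\<psi> \<in> C1c (bdry_layer \<Omega> r)"
    by (rule C1cI[OF open_W compact_supp supp_subset(2) supp_subset(3)[OF r] out(1) d\<psi> cD])
  have gD: "grad \<psi> x = D x" for x
  proof (cases "x \<in> supp s")
    case True
    then show ?thesis using supp_subset(2) d\<psi> grad_eq by blast
  next
    case False
    then show ?thesis
      using grad_eq[OF gderiv_zero_outside[OF compact_imp_closed[OF compact_supp] out(1)]] out(2) by simp
  qed
  define B where "B x = d x powr (\<delta> / 2) *\<^sub>R D x" for x
  have B0: "B x = 0" if "x \<notin> supp s" for x using out(2)[OF that] by (simp add: B_def)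
  have iB: "integrable lborel (\<lambda>x. (norm (B x))\<^sup>2)"
    unfolding B_def
    by (rule integrable_compact_support[OF compact_supp])
      (auto intro!: continuous_intros continuous_on_d_powr supp_subset continuous_on_subset[OF cD] simp: out)
  have A: "(norm (d x powr (\<delta> / 2 - 1) * \<psi> x))\<^sup>2 = (G s x * \<eta> x)\<^sup>2 / d x" for x
  proof (cases "x \<in> supp s")
    case True
    then have pos: "0 < d x" using supp_subset(1) d_pos by blast
    have "(d x powr (\<delta> / 2 - 1) * v x)\<^sup>2 = d x powr (- 1)"
      unfolding v_def \<beta>_def power2_eq_square powr_add[symmetric] by (simp add: field_simps)
    also have "\<dots> = 1 / d x" using pos by (simp add: powr_minus_divide)
    finally have "(d x powr (\<delta> / 2 - 1) * v x)\<^sup>2 * (G s x * \<eta> x)\<^sup>2 = (G s x * \<eta> x)\<^sup>2 / d x"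
      by simp
    then show ?thesis by (simp add: \<psi>_def power_mult_distrib mult.assoc)
  qed (simp add: out outside_supp)
  have L2A: "L2_norm \<Omega> (\<lambda>x. d x powr (\<delta> / 2 - 1) * \<psi> x) = sqrt (energy s)"
    by (subst L2_norm_compact_support[OF supp_subset(1)]) (simp add: out, simp only: A energy_def)
  have L2B: "L2_norm \<Omega> (\<lambda>x. d x powr (\<delta> / 2) *\<^sub>R grad \<psi> x) = sqrt (\<integral>x. (norm (B x))\<^sup>2 \<partial>lborel)"
    unfolding gD by (subst L2_norm_compact_support[OF supp_subset(1)]) (simp_all add: out B_def)
  have e0: "0 \<le> energy s"
    unfolding energy_def by (simp add: bdry_dist_def infdist_nonneg)
  have "sqrt (energy s) \<le> a * sqrt (\<integral>x. (norm (B x))\<^sup>2 \<partial>lborel)"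
    using hardy mem unfolding boundary_hardy_def L2A[symmetric] L2B[symmetric] by blast
  then have "(sqrt (energy s))\<^sup>2 \<le> (a * sqrt (\<integral>x. (norm (B x))\<^sup>2 \<partial>lborel))\<^sup>2"
    using e0 by (intro power_mono) auto
  then have main: "energy s \<le> a\<^sup>2 * (\<integral>x. (norm (B x))\<^sup>2 \<partial>lborel)"
    using e0 by (simp add: power_mult_distrib)
  let ?I = "indicator (cball p R) :: _ \<Rightarrow> real"
  let ?E = "\<lambda>x. (1 + \<theta>) * \<beta>\<^sup>2 * ((G s x * \<eta> x)\<^sup>2 / d x) + (1 + 1 / \<theta>) * (4 * (G' s x * \<eta> x) + 32 / R * ?I x)"
  have pointwise: "(norm (B x))\<^sup>2 \<le> ?E x" for x
  proof (cases "x \<in> supp s")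
    case True
    have pos: "0 < d x" and xO: "x \<in> \<Omega>" using True supp_subset(1) d_pos by blast+
    have xB: "x \<in> cball p R" using True by (simp add: supp_def)
    have n: "norm (\<nu> x) = 1" using True supp_subset(2) norm_normal by blast
    have sq: "(d x powr (\<delta> / 2) * v x)\<^sup>2 = d x"
      using pos unfolding v_def \<beta>_def power2_eq_square powr_add[symmetric] by (simp add: field_simps)
    \<comment> \<open>With \<open>v x\<close> factored out of the gradient, \<open>X\<close> stems
      from the power of the distance, \<open>Y\<close> from the cutoff and \<open>Z\<close> from the
      bump; the square of the remaining weight is \<open>d x\<close> by \<open>sq\<close>.\<close>
    define X where "X = \<bar>\<beta>\<bar> * (G s x * \<eta> x) / d x"
    define Y where "Y = G' s x * \<eta> x"
    define Z where "Z = G s x * norm (D\<eta> x)"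
    have nn: "0 \<le> X" "0 \<le> Y" "0 \<le> Z"
      using pos by (auto simp: X_def Y_def Z_def G_bounds bump_bounds intro!: divide_nonneg_pos)
    have "norm (B x) = (d x powr (\<delta> / 2) * v x) * norm ((\<beta> * (G s x * \<eta> x) / d x + Y) *\<^sub>R \<nu> x + G s x *\<^sub>R D\<eta> x)"
    proof -
      have "B x = (d x powr (\<delta> / 2) * v x) *\<^sub>R ((\<beta> * (G s x * \<eta> x) / d x + Y) *\<^sub>R \<nu> x + G s x *\<^sub>R D\<eta> x)"
        by (simp only: B_def D_def Y_def scaleR_add_right scaleR_scaleR mult.assoc)
      then show ?thesis by (simp add: v_def)
    qed
    moreover have "norm ((\<beta> * (G s x * \<eta> x) / d x + Y) *\<^sub>R \<nu> x + G s x *\<^sub>R D\<eta> x) \<le> X + Y + Z"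
    proof -
      have "norm ((\<beta> * (G s x * \<eta> x) / d x + Y) *\<^sub>R \<nu> x + G s x *\<^sub>R D\<eta> x)
          \<le> \<bar>\<beta> * (G s x * \<eta> x) / d x + Y\<bar> + Z"
        using norm_triangle_ineq[of "(\<beta> * (G s x * \<eta> x) / d x + Y) *\<^sub>R \<nu> x" "G s x *\<^sub>R D\<eta> x"] n G_bounds(1)
        by (simp add: Z_def)
      also have "\<bar>\<beta> * (G s x * \<eta> x) / d x + Y\<bar> \<le> X + Y"
      proof -
        have "\<bar>\<beta> * (G s x * \<eta> x) / d x\<bar> = X"
          using pos G_bounds(1)[of x] bump_bounds(1)[of p R x] by (simp add: X_def abs_mult)
        then show ?thesis using nn(2) by linarith
      qed
      finally show ?thesis by simp
    qed
    ultimately have "norm (B x) \<le> (d x powr (\<delta> / 2) * v x) * (X + Y + Z)"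
      by (simp add: mult_left_mono v_def)
    then have "(norm (B x))\<^sup>2 \<le> ((d x powr (\<delta> / 2) * v x) * (X + Y + Z))\<^sup>2"
      by (intro power_mono) auto
    then have step1: "(norm (B x))\<^sup>2 \<le> d x * (X + (Y + Z))\<^sup>2"
      by (simp add: power_mult_distrib[of "d x powr (\<delta> / 2) * v x"] sq add.assoc)
    \<comment> \<open>The leading factor stays as close to 1 as desired, at the price of
      \<open>1 / \<theta>\<close> in front of the terms that are bounded in
      \<open>s\<close>.\<close>
    have step2: "(X + (Y + Z))\<^sup>2 \<le> (1 + \<theta>) * X\<^sup>2 + (1 + 1 / \<theta>) * (Y + Z)\<^sup>2"
    proof -
      have "0 \<le> (\<theta> * X - (Y + Z))\<^sup>2 / \<theta>" using \<theta> by simp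
      also have "\<dots> = \<theta> * X\<^sup>2 + (Y + Z)\<^sup>2 / \<theta> - 2 * X * (Y + Z)"
        using \<theta> by (simp add: power2_eq_square field_simps)
      finally show ?thesis by (simp add: power2_sum[of X] distrib_right)
    qed
    have "(Y + Z)\<^sup>2 \<le> 2 * Y\<^sup>2 + 2 * Z\<^sup>2"
      using sum_squares_bound[of Y Z] by (simp add: power2_sum)
    then have "(1 + 1 / \<theta>) * (Y + Z)\<^sup>2 \<le> (1 + 1 / \<theta>) * (2 * Y\<^sup>2 + 2 * Z\<^sup>2)"
      by (rule mult_left_mono) (use \<theta> in simp)
    with step2 have "(X + (Y + Z))\<^sup>2 \<le> (1 + \<theta>) * X\<^sup>2 + (1 + 1 / \<theta>) * (2 * Y\<^sup>2 + 2 * Z\<^sup>2)"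
      by linarith
    then have "d x * (X + (Y + Z))\<^sup>2 \<le> d x * ((1 + \<theta>) * X\<^sup>2 + (1 + 1 / \<theta>) * (2 * Y\<^sup>2 + 2 * Z\<^sup>2))"
      by (rule mult_left_mono) (use pos in simp)
    with step1 have "(norm (B x))\<^sup>2 \<le> (1 + \<theta>) * (d x * X\<^sup>2) + (1 + 1 / \<theta>) * (2 * (d x * Y\<^sup>2) + 2 * (d x * Z\<^sup>2))"
      by (simp add: algebra_simps)
    moreover have "d x * X\<^sup>2 = \<beta>\<^sup>2 * ((G s x * \<eta> x)\<^sup>2 / d x)"
      using pos by (simp add: X_def power2_eq_square field_simps)
    \<comment> \<open>One factor \<open>G' s x\<close> is absorbed by
      \<open>d x * G' s x \<le> 2\<close>, so only the first power remains, as in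
      \<open>integral_cutoff_deriv_le\<close>.\<close>
    moreover have "d x * Y\<^sup>2 \<le> 2 * (G' s x * \<eta> x)"
    proof -
      have "d x * Y\<^sup>2 = (d x * G' s x) * (\<eta> x * Y)" by (simp add: Y_def power2_eq_square)
      also have "\<dots> \<le> 2 * (1 * Y)"
        using G_bounds(4)[OF xO] bump_bounds nn(2) pos G_bounds(3)[of x]
        by (intro mult_mono mult_nonneg_nonneg) auto
      finally show ?thesis by (simp add: Y_def)
    qed
    moreover have "d x * Z\<^sup>2 \<le> 16 / R"
    proof -
      have "Z \<le> 1 * (4 / R)"
        unfolding Z_def using G_bounds(1,2)[of x] norm_bump_grad[OF R(1)] by (intro mult_mono) auto
      then have "Z\<^sup>2 \<le> (4 / R)\<^sup>2" using nn(3) by (intro power_mono) auto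
      then have "d x * Z\<^sup>2 \<le> R * (4 / R)\<^sup>2"
        using d_le[OF xB] pos by (intro mult_mono) auto
      then show ?thesis using R(1) by (simp add: power2_eq_square)
    qed
    ultimately have "(norm (B x))\<^sup>2 \<le> (1 + \<theta>) * (\<beta>\<^sup>2 * ((G s x * \<eta> x)\<^sup>2 / d x))
        + (1 + 1 / \<theta>) * (2 * (d x * Y\<^sup>2) + 2 * (d x * Z\<^sup>2))"
      and "2 * (d x * Y\<^sup>2) + 2 * (d x * Z\<^sup>2) \<le> 4 * (G' s x * \<eta> x) + 32 / R"
      by simp_all
    moreover from this(2) have "(1 + 1 / \<theta>) * (2 * (d x * Y\<^sup>2) + 2 * (d x * Z\<^sup>2))
        \<le> (1 + 1 / \<theta>) * (4 * (G' s x * \<eta> x) + 32 / R)"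
      by (rule mult_left_mono) (use \<theta> in simp)
    ultimately show ?thesis using xB by (simp add: mult.assoc)
  next
    case False
    show ?thesis
      unfolding B0[OF False] outside_supp(1,2)[OF False] using \<theta> R(1) by simp
  qed
  have iI: "integrable lborel ?I"
    by (intro integrable_real_indicator emeasure_lborel_cball_finite) simp
  have "(\<integral>x. (norm (B x))\<^sup>2 \<partial>lborel) \<le> (\<integral>x. ?E x \<partial>lborel)"
    using iI integrable_energy integrable_cutoff_deriv
    by (intro integral_mono iB pointwise Bochner_Integration.integrable_add integrable_mult_right)
  also have "\<dots> = (1 + \<theta>) * \<beta>\<^sup>2 * energy s
      + (1 + 1 / \<theta>) * (4 * (\<integral>x. G' s x * \<eta> x \<partial>lborel) + 32 / R * measure lborel (cball p R))"
  proof -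
    have "(\<integral>x. k * f x + m * (4 * g x + n * h x) \<partial>lborel)
        = k * (\<integral>x. f x \<partial>lborel) + m * (4 * (\<integral>x. g x \<partial>lborel) + n * (\<integral>x. h x \<partial>lborel))"
      if "integrable lborel f" "integrable lborel g" "integrable lborel h"
      for f g h :: "real^'a \<Rightarrow> real" and k m n
      using that by simp
    from this[OF integrable_energy integrable_cutoff_deriv iI,
        of "(1 + \<theta>) * \<beta>\<^sup>2" "1 + 1 / \<theta>" "32 / R"]
    show ?thesis by (simp add: energy_def)
  qed
  also have "\<dots> \<le> (1 + \<theta>) * \<beta>\<^sup>2 * energy s
      + (1 + 1 / \<theta>) * (4 * ((\<kappa> + 4 / R) * measure lborel (cball p R)) + 32 / R * measure lborel (cball p R))"
    using \<theta> integral_cutoff_deriv_le by (intro add_left_mono mult_left_mono add_right_mono) auto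
  finally have "a\<^sup>2 * (\<integral>x. (norm (B x))\<^sup>2 \<partial>lborel) \<le> a\<^sup>2 * ((1 + \<theta>) * \<beta>\<^sup>2 * energy s
      + (1 + 1 / \<theta>) * (4 * ((\<kappa> + 4 / R) * measure lborel (cball p R)) + 32 / R * measure lborel (cball p R)))"
    by (rule mult_left_mono) simp
  moreover have "\<beta>\<^sup>2 = ((\<delta> - 1) / 2)\<^sup>2"
    by (simp add: \<beta>_def power2_eq_square field_simps)
  ultimately show ?thesis using main by simp
qed

end

text \<open>Fatou's lemma along \<open>s = 1 / (k + 1)\<close>: the integrands tend to
  \<open>(\<eta> x)\<^sup>2 / d x\<close> on \<Omega>, which on the ball of radius
  \<open>R / 2\<close> is at least a quarter of the inverse distance and thus has infinite
  integral.\<close>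

lemma energy_unbounded:
  assumes \<Omega>: "C11_domain \<Omega>"
  shows "\<exists>s>0. C < energy s"
proof (rule ccontr)
  assume "\<not> ?thesis"
  then have le: "energy s \<le> C" if "s > 0" for s
    using that by force
  define h where "h k x = (G (1 / real (Suc k)) x * \<eta> x)\<^sup>2 / d x" for k x
  define H where "H x = (if x \<in> \<Omega> then (\<eta> x)\<^sup>2 / d x else 0)" for x
  have spos: "1 / real (Suc k) > 0" for k by simp
  have hnn: "0 \<le> h k x" for k x by (simp add: h_def bdry_dist_def infdist_nonneg)
  have hi: "integrable lborel (h k)" for k
    using integrable_energy[OF spos, of k] by (simp add: h_def[abs_def])
  have [measurable]: "h k \<in> borel_measurable borel" for k
    using borel_measurable_integrable[OF hi] by simp
  have hC: "(\<integral>\<^sup>+x. ennreal (h k x) \<partial>lborel) \<le> ennreal C" for k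
  proof -
    have "(\<integral>\<^sup>+x. ennreal (h k x) \<partial>lborel) = ennreal (energy (1 / real (Suc k)))"
      unfolding energy_def h_def[symmetric] by (rule nn_integral_eq_integral[OF hi]) (simp add: hnn)
    then show ?thesis using le[OF spos] by (simp add: ennreal_leI)
  qed
  have lim: "(\<lambda>k. h k x) \<longlonglongrightarrow> H x" for x
  proof (cases "x \<in> \<Omega>")
    case True
    then have "0 < d x" by (rule d_pos)
    have "(\<lambda>k. 1 / real (Suc k)) \<longlonglongrightarrow> 0" by (rule LIMSEQ_Suc[OF lim_1_over_n])
    then have "(\<lambda>k. cutoff (1 / real (Suc k)) (d x)) \<longlonglongrightarrow> (max 0 (1 - 0 / d x))\<^sup>2"
      unfolding cutoff_def using \<open>0 < d x\<close> by (intro tendsto_intros) auto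
    then have "(\<lambda>k. G (1 / real (Suc k)) x) \<longlonglongrightarrow> 1"
      using True by (simp add: G_def)
    then have "(\<lambda>k. h k x) \<longlonglongrightarrow> (1 * \<eta> x)\<^sup>2 / d x"
      unfolding h_def using \<open>0 < d x\<close> by (intro tendsto_intros) auto
    then show ?thesis using True by (simp add: H_def)
  qed (simp add: h_def H_def G_def)
  have "(\<integral>\<^sup>+x. ennreal (H x) \<partial>lborel) = (\<integral>\<^sup>+x. liminf (\<lambda>k. ennreal (h k x)) \<partial>lborel)"
    by (intro nn_integral_cong lim_imp_Liminf[symmetric] tendsto_ennrealI lim) simp
  also have "\<dots> \<le> liminf (\<lambda>k. \<integral>\<^sup>+x. ennreal (h k x) \<partial>lborel)"
    by (rule nn_integral_liminf) simp
  also have "\<dots> \<le> liminf (\<lambda>k. ennreal C)"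
    by (intro Liminf_mono always_eventually allI hC)
  also have "\<dots> = ennreal C" by (simp add: Liminf_const)
  finally have upper: "(\<integral>\<^sup>+x. ennreal (H x) \<partial>lborel) \<le> ennreal C" .
  define f where "f x = indicator (\<Omega> \<inter> ball p (R / 2)) x * ennreal (1 / d x)" for x
  have "ennreal (1 / 4) * f x \<le> ennreal (H x)" for x
  proof (cases "x \<in> \<Omega> \<inter> ball p (R / 2)")
    case True
    then have "1 / 4 * (1 / d x) \<le> (\<eta> x)\<^sup>2 * (1 / d x)"
      using bump_inner_ball[of x p R] R(1) d_pos[of x] by (intro mult_right_mono) auto
    then have "ennreal (1 / 4 * (1 / d x)) \<le> ennreal (H x)"
      using True by (intro ennreal_leI) (simp add: H_def)
    then show ?thesis
      using True d_pos[of x] by (simp add: f_def ennreal_mult[symmetric])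
  qed (simp add: f_def)
  then have "(\<integral>\<^sup>+x. ennreal (1 / 4) * f x \<partial>lborel) \<le> (\<integral>\<^sup>+x. ennreal (H x) \<partial>lborel)"
    by (intro nn_integral_mono)
  moreover have "f \<in> borel_measurable borel"
    unfolding f_def
    by (intro borel_measurable_times_ennreal borel_measurable_indicator
        measurable_compose[OF borel_measurable_divide measurable_ennreal])
       (auto intro!: borel_measurable_continuous_onI continuous_on_bdry_dist simp: open_domain)
  moreover have "(\<integral>\<^sup>+x. f x \<partial>lborel) = \<infinity>"
    unfolding f_def using R(1) by (intro nn_integral_inverse_bdry_dist \<Omega> p) simp
  ultimately have "\<infinity> \<le> ennreal C"
    using upper by (simp add: nn_integral_cmult ennreal_mult_top top.extremum_unique)
  then show False by (simp add: top.extremum_unique)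
qed

text \<open>A smaller \<open>a\<close> would make the coefficient of \<open>energy s\<close> on the
  right of \<open>hardy_imp_energy_le\<close> less than 1 for small \<open>\<theta>\<close>, hence
  bound the energy uniformly in \<open>s\<close>.\<close>

lemma hardy_const_lower_bound:
  assumes \<Omega>: "C11_domain \<Omega>" and hardy: "boundary_hardy \<Omega> \<delta> r a" and r: "R < r" and a: "a > 0"
  shows "2 \<le> a * \<bar>\<delta> - 1\<bar>"
proof (rule ccontr)
  assume "\<not> ?thesis"
  then have lt: "a * \<bar>\<delta> - 1\<bar> < 2" by simp
  define q where "q = (a * \<bar>\<delta> - 1\<bar> / 2)\<^sup>2"
  have q: "0 \<le> q" "q < 1"
  proof -
    have "(a * \<bar>\<delta> - 1\<bar> / 2)\<^sup>2 < 1\<^sup>2"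
      using lt a by (intro power_strict_mono) auto
    then show "0 \<le> q" "q < 1" by (simp_all add: q_def)
  qed
  \<comment> \<open>Half of the gap below 1:
    \<open>(1 + \<theta>) * q \<le> q + \<theta> = (1 + q) / 2\<close>.\<close>
  define \<theta> where "\<theta> = (1 - q) / 2"
  have \<theta>: "\<theta> > 0" using q by (simp add: \<theta>_def)
  have contraction: "(1 + \<theta>) * q < 1"
  proof -
    have "(1 + \<theta>) * q \<le> q + \<theta> * 1"
      using q \<theta> by (simp add: distrib_right mult_left_le)
    also have "\<dots> < 1" using q by (simp add: \<theta>_def field_simps)
    finally show ?thesis .
  qed
  define C where "C = a\<^sup>2 * ((1 + 1 / \<theta>) * (4 * ((\<kappa> + 4 / R) * measure lborel (cball p R)) + 32 / R * measure lborel (cball p R)))"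
  have bound: "energy s \<le> (1 + \<theta>) * q * energy s + C" if "s > 0" for s
  proof -
    have "a\<^sup>2 * ((1 + \<theta>) * ((\<delta> - 1) / 2)\<^sup>2 * energy s) = (1 + \<theta>) * q * energy s"
      by (simp add: q_def power_mult_distrib power_divide)
    then show ?thesis
      using hardy_imp_energy_le[OF that hardy r \<theta>] by (simp only: C_def distrib_left)
  qed
  obtain s where s: "s > 0" "C / (1 - (1 + \<theta>) * q) < energy s"
    using energy_unbounded[OF \<Omega>] by blast
  then have "C < (1 - (1 + \<theta>) * q) * energy s"
    using contraction by (simp add: pos_divide_less_eq mult.commute)
  then show False using bound[OF s(1)] by (simp add: left_diff_distrib)
qed

end

theorem theorem4p3:
  fixes \<Omega> :: "(real ^ 'd) set" and \<delta> :: real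
  assumes "C11_domain \<Omega>" and "frontier \<Omega> \<noteq> {}"
    and "\<delta> \<ge> 0" and "\<delta> \<noteq> 1"
  shows "(\<exists>r\<^sub>0>0. \<forall>r. 0 < r \<and> r < r\<^sub>0 \<longrightarrow> (\<exists>a>0. boundary_hardy \<Omega> \<delta> r a)) \<and>
    boundary_hardy_const \<Omega> \<delta> = ereal (2 / \<bar>\<delta> - 1\<bar>)"
proof -
  obtain \<rho> c \<nu> where \<rho>: "\<rho> > 0" "c > 0"
    and \<nu>: "\<And>x. x \<in> bdry_layer \<Omega> \<rho> \<Longrightarrow> norm (\<nu> x) = 1"
      "\<And>x z. x \<in> bdry_layer \<Omega> \<rho> \<Longrightarrow> z \<in> \<Omega> \<Longrightarrow>
       \<bar>bdry_dist \<Omega> z - bdry_dist \<Omega> x - \<nu> x \<bullet> (z - x)\<bar> \<le> c * (norm (z - x))\<^sup>2"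
    using bdry_dist_quadratic[OF assms(1,2)] by metis
  interpret regular_layer \<Omega> \<rho> c \<nu>
    using assms(1,2) \<rho> \<nu> by unfold_locales (auto simp: C11_domain_def)
  define l where "l = \<bar>\<delta> - 1\<bar>"
  have l: "l > 0" using assms(4) by (simp add: l_def)
  have upper: "boundary_hardy \<Omega> \<delta> r (2 / (l - \<kappa> * r))" if "0 < r" "r \<le> \<rho>" "\<kappa> * r < l" for r
    using that by (intro hardy_on_layer) (auto simp: l_def)
  \<comment> \<open>At width \<open>l / \<kappa>\<close> the constant
    \<open>2 / (l - \<kappa> * r)\<close> blows up.\<close>
  define r\<^sub>0 where "r\<^sub>0 = min \<rho> (l / \<kappa>)"
  have r\<^sub>0: "r\<^sub>0 > 0" using \<rho>(1) l \<kappa>_pos by (simp add: r\<^sub>0_def)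
  have small: "r \<le> \<rho>" "\<kappa> * r < l" if "r < r\<^sub>0" for r
    using that \<kappa>_pos by (auto simp: r\<^sub>0_def field_simps)
  have "\<exists>a>0. boundary_hardy \<Omega> \<delta> r a" if "0 < r" "r < r\<^sub>0" for r
    using upper[OF that(1) small[OF that(2)]] small(2)[OF that(2)]
    by (intro exI[of _ "2 / (l - \<kappa> * r)"]) auto
  moreover have "boundary_hardy_const \<Omega> \<delta> = ereal (2 / l)"
  proof (rule antisym)
    have le: "boundary_hardy_const \<Omega> \<delta> \<le> ereal (2 / (l - \<kappa> * r))" if "0 < r" "r < r\<^sub>0" for r
    proof -
      have "layer_hardy_const \<Omega> \<delta> r \<le> ereal (2 / (l - \<kappa> * r))"
        unfolding layer_hardy_const_def
        using upper[OF that(1) small[OF that(2)]] small(2)[OF that(2)] by (intro Inf_lower) auto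
      then show ?thesis
        unfolding boundary_hardy_const_def using that(1) by (intro INF_lower2[of r]) auto
    qed
    \<comment> \<open>The infimum over all layers is below each of these constants, hence below
      their limit as \<open>r\<close> decreases to 0.\<close>
    have "((\<lambda>r. ereal (2 / (l - \<kappa> * r))) \<longlongrightarrow> ereal (2 / (l - \<kappa> * 0))) (at_right 0)"
      using l by (intro tendsto_intros) auto
    moreover have "eventually (\<lambda>r. boundary_hardy_const \<Omega> \<delta> \<le> ereal (2 / (l - \<kappa> * r))) (at_right 0)"
      using le r\<^sub>0 by (auto simp: eventually_at_right)
    ultimately show "boundary_hardy_const \<Omega> \<delta> \<le> ereal (2 / l)"
      using tendsto_lowerbound[OF _ _ trivial_limit_at_right_real] by fastforce
  next
    obtain p where p: "p \<in> frontier \<Omega>" using assms(2) by blast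
    show "ereal (2 / l) \<le> boundary_hardy_const \<Omega> \<delta>"
      unfolding boundary_hardy_const_def layer_hardy_const_def
    proof (intro INF_greatest Inf_greatest)
      fix r y assume r: "r \<in> {0<..}" and "y \<in> {ereal a |a. a > 0 \<and> boundary_hardy \<Omega> \<delta> r a}"
      then obtain a where a: "y = ereal a" "a > 0" "boundary_hardy \<Omega> \<delta> r a" by blast
      \<comment> \<open>The radius lies below both \<open>\<rho>\<close> and \<open>r\<close>, so
        the lower bound covers layers of every width.\<close>
      interpret boundary_bump \<Omega> \<rho> c \<nu> p "min \<rho> r / 2"
        using r \<rho>(1) p by unfold_locales (auto simp: min_def)
      have "2 \<le> a * l"
        unfolding l_def by (rule hardy_const_lower_bound[OF assms(1) a(3) _ a(2)]) (use r in auto)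
      then show "ereal (2 / l) \<le> y" using a(1) l by (simp add: pos_divide_le_eq)
    qed
  qed
  ultimately show ?thesis using r\<^sub>0 unfolding l_def by blast
qed

end
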